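(* Let $m\in(0,2]$, let $f(q)=\sum_{k=0}^{\infty} q^kp_k\in \mathcal{SB}(\mathbb{B})$, and let $\omega_k\in\mathcal{SB}_k(\mathbb{B})$ for each $k\geq 1$. Then $$|p_0|^m+\sum_{k=1}^{\infty}|\omega_k(q)p_k|\leq 1\quad\text{for all } q \text{ with } |q|\leq R_m:=\frac{m}{2+m}.$$ The constant $R_m$ is best possible for each $m\in(0,2]$, i.e. for fixed $m$ it cannot be replaced by any larger number so that the inequality remains true for all such $f$ and $(\omega_k)_{k\ge1}$.
   Context: $\mathbb{H}$ is the skew field of quaternions with its usual modulus $|\cdot|$; $\mathbb{B}=\{q\in\mathbb{H}:|q|<1\}$ with closure $\overline{\mathbb{B}}$. Let $\mathbb{S}=\{q\in\mathbb{H}:q^2=-1\}$ and, for $I\in\mathbb{S}$, $\mathbb{C}_I=\mathbb{R}\oplus I\mathbb{R}$ and $\mathbb{B}_I=\mathbb{B}\cap\mathbb{C}_I$. A function $f:\mathbb{B}\to\mathbb{H}$ is (left) slice regular if for every $I\in\mathbb{S}$ its restriction $f_I$ to $\mathbb{B}_I$ has continuous partial derivatives and satisfies $\frac12\left(\frac{\partial}{\partial x}+I\frac{\partial}{\partial y}\right)f_I(x+yI)=0$ for all $x+yI\in\mathbb{B}_I$. Every slice regular $f$ on $\mathbb{B}$ has a power series expansion $f(q)=\sum_{k=0}^\infty q^kp_k$ on $\mathbb{B}$ with $p_k\in\mathbb{H}$. The slice derivative $f'$ is defined on each $\mathbb{B}_I$ by $f'(x+yI)=\frac12\left(\frac{\partial}{\partial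 x}-I\frac{\partial}{\partial y}\right)f_I(x+yI)$; $f^{(j)}$ denotes the $j$-th iterated slice derivative, so $p_k=f^{(k)}(0)/k!$. $\mathcal{SB}(\mathbb{B})$ is the class of slice regular functions $f(q)=\sum_{k=0}^{\infty}q^kp_k$ on $\mathbb{B}$, continuous on $\overline{\mathbb{B}}$, such that $|f(q)|<1$ for all $|q|\leq 1$. For $n\geq1$, $\mathcal{SB}_n(\mathbb{B})$ is the set of $\omega\in\mathcal{SB}(\mathbb{B})$ with $\omega(0)=\omega'(0)=\dots=\omega^{(n-1)}(0)=0$ but $\omega^{(n)}(0)\neq0$. *)

theory Defs
  imports "HOL-Analysis.Analysis"
begin

section \<open>The skew field of quaternions\<close>

datatype quat = Quat (qRe: real) (qI: real) (qJ: real) (qK: real)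

lemma quat_eq_iff:
  "p = q \<longleftrightarrow> qRe p = qRe q \<and> qI p = qI q \<and> qJ p = qJ q \<and> qK p = qK q"
  by (cases p; cases q) auto

instantiation quat :: ring_1
begin

definition zero_quat :: quat where "0 = Quat 0 0 0 0"

definition one_quat :: quat where "1 = Quat 1 0 0 0"

definition plus_quat :: "quat \<Rightarrow> quat \<Rightarrow> quat" where
  "p + q = Quat (qRe p + qRe q) (qI p + qI q) (qJ p + qJ q) (qK p + qK q)"

definition uminus_quat :: "quat \<Rightarrow> quat" where
  "- p = Quat (- qRe p) (- qI p) (- qJ p) (- qK p)"

definition minus_quat :: "quat \<Rightarrow> quat \<Rightarrow> quat" where
  "p - q = Quat (qRe p - qRe q) (qI p - qI q) (qJ p - qJ q) (qK p - qK q)"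

definition times_quat :: "quat \<Rightarrow> quat \<Rightarrow> quat" where
  "p * q = Quat
     (qRe p * qRe q - qI p * qI q - qJ p * qJ q - qK p * qK q)
     (qRe p * qI q + qI p * qRe q + qJ p * qK q - qK p * qJ q)
     (qRe p * qJ q - qI p * qK q + qJ p * qRe q + qK p * qI q)
     (qRe p * qK q + qI p * qJ q - qJ p * qI q + qK p * qRe q)"

instance
  by standard
    (simp_all add: zero_quat_def one_quat_def plus_quat_def uminus_quat_def
      minus_quat_def times_quat_def quat_eq_iff algebra_simps)

end

lemma quat_simps [simp]:
  "qRe 0 = 0" "qI 0 = 0" "qJ 0 = 0" "qK 0 = 0"
  "qRe 1 = 1" "qI 1 = 0" "qJ 1 = 0" "qK 1 = 0"
  "qRe (p + q) = qRe p + qRe q" "qI (p + q) = qI p + qI q"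
  "qJ (p + q) = qJ p + qJ q" "qK (p + q) = qK p + qK q"
  "qRe (p - q) = qRe p - qRe q" "qI (p - q) = qI p - qI q"
  "qJ (p - q) = qJ p - qJ q" "qK (p - q) = qK p - qK q"
  "qRe (- p) = - qRe p" "qI (- p) = - qI p" "qJ (- p) = - qJ p" "qK (- p) = - qK p"
  by (simp_all add: zero_quat_def one_quat_def plus_quat_def uminus_quat_def minus_quat_def)

lemma quat_times_simps [simp]:
  "qRe (p * q) = qRe p * qRe q - qI p * qI q - qJ p * qJ q - qK p * qK q"
  "qI (p * q) = qRe p * qI q + qI p * qRe q + qJ p * qK q - qK p * qJ q"
  "qJ (p * q) = qRe p * qJ q - qI p * qK q + qJ p * qRe q + qK p * qI q"
  "qK (p * q) = qRe p * qK q + qI p * qJ q - qJ p * qI q + qK p * qRe q"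
  by (simp_all add: times_quat_def)

instantiation quat :: real_algebra_1
begin

definition scaleR_quat :: "real \<Rightarrow> quat \<Rightarrow> quat" where
  "a *\<^sub>R q = Quat (a * qRe q) (a * qI q) (a * qJ q) (a * qK q)"

instance
  by standard (simp_all add: scaleR_quat_def quat_eq_iff algebra_simps)

end

lemma quat_scaleR_simps [simp]:
  "qRe (a *\<^sub>R q) = a * qRe q" "qI (a *\<^sub>R q) = a * qI q"
  "qJ (a *\<^sub>R q) = a * qJ q" "qK (a *\<^sub>R q) = a * qK q"
  by (simp_all add: scaleR_quat_def)

lemma quat_of_real_simps [simp]:
  "qRe (of_real a) = a" "qI (of_real a) = 0" "qJ (of_real a) = 0" "qK (of_real a) = 0"
  by (simp_all add: of_real_def)

instantiation quat :: real_inner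
begin

definition inner_quat :: "quat \<Rightarrow> quat \<Rightarrow> real" where
  "inner p q = qRe p * qRe q + qI p * qI q + qJ p * qJ q + qK p * qK q"

definition norm_quat :: "quat \<Rightarrow> real" where
  "norm q = sqrt ((qRe q)\<^sup>2 + (qI q)\<^sup>2 + (qJ q)\<^sup>2 + (qK q)\<^sup>2)"

definition sgn_quat_def: "sgn q = q /\<^sub>R norm q" for q :: quat

definition dist_quat_def: "dist p q = norm (p - q)" for p q :: quat

definition uniformity_quat_def:
  "(uniformity :: (quat \<times> quat) filter) = (INF e\<in>{0<..}. principal {(p, q). dist p q < e})"

definition open_quat_def:
  "open (U :: quat set) \<longleftrightarrow> (\<forall>p\<in>U. eventually (\<lambda>(p', q). p' = p \<longrightarrow> q \<in> U) uniformity)"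

instance
proof
  fix p q r :: quat and a :: real and U :: "quat set"
  show "dist p q = norm (p - q)" by (rule dist_quat_def)
  show "sgn q = q /\<^sub>R norm q" by (rule sgn_quat_def)
  show "(uniformity :: (quat \<times> quat) filter) = (INF e\<in>{0<..}. principal {(p, q). dist p q < e})"
    by (rule uniformity_quat_def)
  show "open U \<longleftrightarrow> (\<forall>p\<in>U. eventually (\<lambda>(p', q). p' = p \<longrightarrow> q \<in> U) uniformity)"
    by (rule open_quat_def)
  show "inner p q = inner q p"
    by (simp add: inner_quat_def mult.commute)
  show "inner (p + q) r = inner p r + inner q r"
    by (simp add: inner_quat_def algebra_simps)
  show "inner (a *\<^sub>R p) q = a * inner p q"
    by (simp add: inner_quat_def algebra_simps)
  show "0 \<le> inner p p"
    by (simp add: inner_quat_def)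
  show "inner p p = 0 \<longleftrightarrow> p = 0"
    by (simp add: inner_quat_def quat_eq_iff add_nonneg_eq_0_iff)
  show "norm p = sqrt (inner p p)"
    by (simp add: inner_quat_def norm_quat_def power2_eq_square)
qed

end

lemma norm_quat_mult: "norm (p * q) = norm p * norm (q :: quat)"
  unfolding norm_quat_def real_sqrt_mult [symmetric]
  by (rule arg_cong [where f = sqrt]) (simp add: power2_eq_square algebra_simps)

instantiation quat :: real_normed_div_algebra
begin

definition inverse_quat :: "quat \<Rightarrow> quat" where
  "inverse q = Quat (qRe q) (- qI q) (- qJ q) (- qK q) /\<^sub>R (norm q)\<^sup>2"

definition divide_quat_def: "p div q = p * inverse q" for p q :: quat

instance
proof
  fix p q :: quat
  define s where "s = (norm q)\<^sup>2"
  define c where "c = Quat (qRe q) (- qI q) (- qJ q) (- qK q)"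
  have s: "s = (qRe q)\<^sup>2 + (qI q)\<^sup>2 + (qJ q)\<^sup>2 + (qK q)\<^sup>2"
    by (simp add: s_def norm_quat_def)
  have inv: "inverse q = c /\<^sub>R s"
    by (simp add: inverse_quat_def c_def s_def)
  have c: "c * q = s *\<^sub>R 1" "q * c = s *\<^sub>R 1"
    by (simp_all add: quat_eq_iff c_def s power2_eq_square)
  show "inverse q * q = 1" "q * inverse q = 1" if "q \<noteq> 0"
    using that by (simp_all add: inv c s_def)
  show "p div q = p * inverse q" by (rule divide_quat_def)
  show "inverse (0 :: quat) = 0" by (simp add: inverse_quat_def quat_eq_iff)
  show "norm (p * q) = norm p * norm q" by (rule norm_quat_mult)
qed

end

instantiation quat :: euclidean_space
begin

definition Basis_quat :: "quat set" where
  "Basis = {Quat 1 0 0 0, Quat 0 1 0 0, Quat 0 0 1 0, Quat 0 0 0 1}"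

instance
proof
  show "(Basis :: quat set) \<noteq> {}" "finite (Basis :: quat set)"
    by (simp_all add: Basis_quat_def)
  show "inner u v = (if u = v then 1 else 0)" if "u \<in> Basis" "v \<in> Basis" for u v :: quat
    using that unfolding Basis_quat_def by (elim insertE emptyE) (simp_all add: inner_quat_def)
  show "(\<forall>u\<in>Basis. inner x u = 0) \<longleftrightarrow> x = 0" for x :: quat
    by (simp add: Basis_quat_def inner_quat_def quat_eq_iff [of x 0])
qed

end


section \<open>Slice regular functions on the unit ball\<close>

definition imag_units :: "quat set" where
  "imag_units = {q. q\<^sup>2 = - 1}"

definition slice_pt :: "quat \<Rightarrow> real \<Rightarrow> real \<Rightarrow> quat" where
  "slice_pt I x y = of_real x + of_real y * I"

text \<open>
  Functions on the unit ball or its closure are total functions on \<^typ>\<open>quat\<close>;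
  the values outside are never used. The partial derivatives of the
  restriction of \<open>f\<close> to a slice at an interior point depend only on the values
  of \<open>f\<close> near that point.
\<close>

definition slice_dx :: "quat \<Rightarrow> (quat \<Rightarrow> quat) \<Rightarrow> real \<Rightarrow> real \<Rightarrow> quat" where
  "slice_dx I f x y = vector_derivative (\<lambda>t. f (slice_pt I t y)) (at x)"

definition slice_dy :: "quat \<Rightarrow> (quat \<Rightarrow> quat) \<Rightarrow> real \<Rightarrow> real \<Rightarrow> quat" where
  "slice_dy I f x y = vector_derivative (\<lambda>t. f (slice_pt I x t)) (at y)"

definition slice_regular :: "(quat \<Rightarrow> quat) \<Rightarrow> bool" where
  "slice_regular f \<longleftrightarrow>
     (\<forall>I\<in>imag_units.
        (\<forall>x y. slice_pt I x y \<in> ball 0 1 \<longrightarrow>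
           (\<lambda>t. f (slice_pt I t y)) differentiable at x \<and>
           (\<lambda>t. f (slice_pt I x t)) differentiable at y \<and>
           (1/2) *\<^sub>R (slice_dx I f x y + I * slice_dy I f x y) = 0) \<and>
        continuous_on {(x, y). slice_pt I x y \<in> ball 0 1} (\<lambda>(x, y). slice_dx I f x y) \<and>
        continuous_on {(x, y). slice_pt I x y \<in> ball 0 1} (\<lambda>(x, y). slice_dy I f x y))"

text \<open>
  A quaternion has several representations \<open>x + y I\<close>. The value below is the common
  value for all of them; it exists in the unit ball if \<open>f\<close> is slice regular,
  see \<open>slice_deriv_eq\<close>.
\<close>

definition slice_deriv :: "(quat \<Rightarrow> quat) \<Rightarrow> quat \<Rightarrow> quat" where
  "slice_deriv f q =
     (THE d. \<forall>I\<in>imag_units. \<forall>x y. q = slice_pt I x y \<longrightarrow>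
        d = (1/2) *\<^sub>R (slice_dx I f x y - I * slice_dy I f x y))"

lemma imag_units_iff:
  "I \<in> imag_units \<longleftrightarrow> qRe I = 0 \<and> (qI I)\<^sup>2 + (qJ I)\<^sup>2 + (qK I)\<^sup>2 = 1"
proof
  assume "I \<in> imag_units"
  then have sq: "I * I = - 1"
    by (simp add: imag_units_def power2_eq_square)
  have 1: "qRe I * qRe I - qI I * qI I - qJ I * qJ I - qK I * qK I = - 1"
    using arg_cong [OF sq, of qRe] by simp
  have 2: "qRe I * qI I = 0" "qRe I * qJ I = 0" "qRe I * qK I = 0"
    using arg_cong [OF sq, of qI] arg_cong [OF sq, of qJ] arg_cong [OF sq, of qK]
    by (simp_all add: algebra_simps)
  have "qRe I = 0"
  proof (rule ccontr)
    assume "qRe I \<noteq> 0"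
    with 1 2 have "qRe I * qRe I = - 1" by simp
    then show False
      using zero_le_square [of "qRe I"] by linarith
  qed
  with 1 show "qRe I = 0 \<and> (qI I)\<^sup>2 + (qJ I)\<^sup>2 + (qK I)\<^sup>2 = 1"
    by (simp add: power2_eq_square)
next
  assume "qRe I = 0 \<and> (qI I)\<^sup>2 + (qJ I)\<^sup>2 + (qK I)\<^sup>2 = 1"
  then show "I \<in> imag_units"
    by (auto simp: imag_units_def power2_eq_square quat_eq_iff)
qed

lemma slice_pt_eqD:
  assumes I: "I \<in> imag_units" and J: "J \<in> imag_units"
    and eq: "slice_pt I x y = slice_pt J u v"
  shows "u = x" and "y = 0 \<and> v = 0 \<or> J = I \<and> v = y \<or> J = - I \<and> v = - y"
proof -
  have re: "qRe I = 0" "qRe J = 0"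
    and nI: "(qI I)\<^sup>2 + (qJ I)\<^sup>2 + (qK I)\<^sup>2 = 1"
    and nJ: "(qI J)\<^sup>2 + (qJ J)\<^sup>2 + (qK J)\<^sup>2 = 1"
    using I J by (auto simp: imag_units_iff)
  have c: "u = x" "y * qI I = v * qI J" "y * qJ I = v * qJ J" "y * qK I = v * qK J"
    using eq re by (auto simp: slice_pt_def quat_eq_iff)
  then show "u = x" by blast
  have "y\<^sup>2 = (y * qI I)\<^sup>2 + (y * qJ I)\<^sup>2 + (y * qK I)\<^sup>2"
    using nI by (simp add: power_mult_distrib flip: distrib_left)
  also have "\<dots> = v\<^sup>2"
    unfolding c using nJ by (simp add: power_mult_distrib flip: distrib_left)
  finally have "v = y \<or> v = - y"
    by (auto simp: power2_eq_iff)
  then show "y = 0 \<and> v = 0 \<or> J = I \<and> v = y \<or> J = - I \<and> v = - y"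
  proof
    assume "v = y"
    with c re show ?thesis
      by (cases "y = 0") (simp_all add: quat_eq_iff)
  next
    assume v: "v = - y"
    with c have "y * qI I = y * (- qI J)" "y * qJ I = y * (- qJ J)" "y * qK I = y * (- qK J)"
      by simp_all
    with v re show ?thesis
      unfolding mult_cancel_left by (cases "y = 0") (simp_all add: quat_eq_iff)
  qed
qed

lemma slice_deriv_eq:
  assumes f: "slice_regular f" and I: "I \<in> imag_units" and q: "slice_pt I x y \<in> ball 0 1"
  shows "slice_deriv f (slice_pt I x y) =
           (1/2) *\<^sub>R (slice_dx I f x y - I * slice_dy I f x y)"
  unfolding slice_deriv_def
proof (rule the_equality)
  show "\<forall>J\<in>imag_units. \<forall>u v. slice_pt I x y = slice_pt J u v \<longrightarrow>
      (1/2) *\<^sub>R (slice_dx I f x y - I * slice_dy I f x y) =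
      (1/2) *\<^sub>R (slice_dx J f u v - J * slice_dy J f u v)"
  proof (intro ballI allI impI)
    fix J u v
    assume J: "J \<in> imag_units" and eq: "slice_pt I x y = slice_pt J u v"
    have u: "u = x" by (rule slice_pt_eqD [OF I J eq])
    consider "y = 0" "v = 0" | "J = I" "v = y" | "J = - I" "v = - y"
      using slice_pt_eqD(2) [OF I J eq] by blast
    then show "(1/2) *\<^sub>R (slice_dx I f x y - I * slice_dy I f x y) =
        (1/2) *\<^sub>R (slice_dx J f u v - J * slice_dy J f u v)"
    proof cases
      case 1
      have CR: "slice_dx K f a b = - (K * slice_dy K f a b)"
        if "K \<in> imag_units" "slice_pt K a b \<in> ball 0 1" for K a b
      proof -
        have "(1/2) *\<^sub>R (slice_dx K f a b + K * slice_dy K f a b) = 0"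
          using f that unfolding slice_regular_def by blast
        then have "slice_dx K f a b + K * slice_dy K f a b = 0"
          by (simp only: scaleR_eq_0_iff) simp
        then show ?thesis
          by (simp only: add_eq_0_iff2)
      qed
      have "slice_dx I f x 0 = slice_dx J f x 0"
        by (simp add: slice_dx_def slice_pt_def)
      then show ?thesis
        using CR [OF I q] CR [OF J, of u v] q eq 1 u
        by (metis diff_minus_eq_add minus_minus)
    next
      case 2
      then show ?thesis using u by simp
    next
      case 3
      have dx: "slice_dx (- I) f x (- y) = slice_dx I f x y"
        by (simp add: slice_dx_def slice_pt_def)
      have "(\<lambda>t. f (slice_pt I x t)) differentiable at y"
        using f I q unfolding slice_regular_def by blast
      then have "((\<lambda>t. f (slice_pt I x t)) has_vector_derivative slice_dy I f x y) (at (- (- y)))"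
        by (simp add: slice_dy_def vector_derivative_works)
      moreover have "(uminus has_vector_derivative (- 1 :: real)) (at (- y))"
        by (auto intro!: derivative_eq_intros)
      ultimately have
        "((\<lambda>t. f (slice_pt I x t)) \<circ> uminus has_vector_derivative (- 1) *\<^sub>R slice_dy I f x y) (at (- y))"
        by (intro vector_diff_chain_at)
      then have "slice_dy (- I) f x (- y) = - slice_dy I f x y"
        unfolding slice_dy_def [of "- I"]
        by (intro vector_derivative_at) (simp add: o_def slice_pt_def)
      with dx 3 u show ?thesis by simp
    qed
  qed
qed (use I in blast)


section \<open>The classes of bounded slice regular functions\<close>

definition SB :: "(quat \<Rightarrow> quat) set" where
  "SB = {f. slice_regular f \<and> continuous_on (cball 0 1) f \<and> (\<forall>q\<in>cball 0 1. norm (f q) < 1)}"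

definition SBn :: "nat \<Rightarrow> (quat \<Rightarrow> quat) set" where
  "SBn n = {\<omega> \<in> SB. (\<forall>j<n. (slice_deriv ^^ j) \<omega> 0 = 0) \<and> (slice_deriv ^^ n) \<omega> 0 \<noteq> 0}"

text \<open>The right coefficients of the power series expansion of \<open>f\<close> on the unit ball.\<close>

definition has_slice_expansion :: "(quat \<Rightarrow> quat) \<Rightarrow> (nat \<Rightarrow> quat) \<Rightarrow> bool" where
  "has_slice_expansion f p \<longleftrightarrow> (\<forall>q\<in>ball 0 1. (\<lambda>k. q ^ k * p k) sums f q)"

text \<open>
  Since \<^const>\<open>suminf\<close> is unspecified for divergent series, the
  assertion that a series of nonnegative terms is bounded includes its convergence.
\<close>

definition bohr_ineq ::
  "real \<Rightarrow> (nat \<Rightarrow> quat) \<Rightarrow> (nat \<Rightarrow> quat \<Rightarrow> quat) \<Rightarrow> quat \<Rightarrow> bool" where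
  "bohr_ineq m p \<omega> q \<longleftrightarrow>
     summable (\<lambda>k. norm (\<omega> (Suc k) q * p (Suc k))) \<and>
     norm (p 0) powr m + (\<Sum>k. norm (\<omega> (Suc k) q * p (Suc k))) \<le> 1"

end

theory Submission
  imports Defs "HOL-Complex_Analysis.Complex_Analysis"
begin

text \<open>
  Everything is reduced to holomorphic functions on the unit disc: restricting \<open>f\<close> to the
  slice of \<open>I\<close>, multiplying by a constant \<open>c\<close> on the right and projecting onto the slice gives a
  holomorphic function, since the projection is linear for left multiplication by the slice.
  If \<open>c\<close> is a unit that makes a given value real, that value keeps its modulus. So the
  Schwarz lemma yields \<open>norm (\<omega> k q) \<le> norm q ^ k\<close>; and if \<open>p 0 * c\<close> is real and \<open>I\<close> is chosen
  such that \<open>p k * c\<close> lies in the slice of \<open>I\<close>, the classical coefficient estimate yields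
  \<open>norm (p k) \<le> 1 - (norm (p 0))\<^sup>2\<close>. Summing the geometric series reduces the inequality to
  Bernoulli's \<open>t powr (m / 2) \<le> 1 + (m / 2) * (t - 1)\<close> at \<open>t = (norm (p 0))\<^sup>2\<close>.

  The radius is optimal by \<open>f q = s (a - q) (1 - a q)\<^sup>-\<^sup>1\<close> and \<open>\<omega> k q = s q ^ k\<close> with \<open>a\<close>, then \<open>s\<close>,
  close to \<open>1\<close>; the factor \<open>s < 1\<close> is there because the bounds in \<^const>\<open>SB\<close> are strict
  on the closed ball.
\<close>

section \<open>Bounded holomorphic functions on the unit disc\<close>

text \<open>The vanishing low coefficients let \<open>z ^ k\<close> be divided out of the power
  series. The maximum principle on the circle of radius \<open>r < 1\<close> bounds the quotient by
  \<open>1 / r ^ k\<close>; then \<open>r\<close> tends to \<open>1\<close>, since \<open>h\<close>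
  is controlled only inside the disc.\<close>

lemma Schwarz_lemma_order:
  fixes h :: "complex \<Rightarrow> complex"
  assumes holo: "h holomorphic_on ball 0 1"
    and bound: "\<And>z. norm z < 1 \<Longrightarrow> norm (h z) \<le> 1"
    and zero: "\<And>j. j < k \<Longrightarrow> (deriv ^^ j) h 0 = 0"
    and z: "norm z < 1"
  shows "norm (h z) \<le> norm z ^ k"
proof -
  define a where "a n = (deriv ^^ n) h 0 / fact n" for n
  have a0: "a j = 0" if "j < k" for j
    using zero [OF that] by (simp add: a_def)
  have sums_h: "(\<lambda>n. a n * w ^ n) sums h w" if "norm w < 1" for w
    using holomorphic_power_series [OF holo, of w] that by (simp add: a_def)
  define g where "g w = (if w = 0 then a k else h w / w ^ k)" for w
  have h_eq: "h w = w ^ k * g w" if "norm w < 1" for w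
  proof (cases "w = 0")
    case True
    have "h 0 = a 0" using sums_h [of 0] by (simp add: sums_iff)
    then show ?thesis using True a0 [of 0] by (cases "k = 0") (auto simp: g_def)
  qed (simp add: g_def)
  have sums_g: "(\<lambda>n. a (n + k) * (w - 0) ^ n) sums g w" if "w \<in> ball 0 1" for w
  proof (cases "w = 0")
    case True
    then show ?thesis using powser_sums_zero [of "\<lambda>n. a (n + k)"] by (simp add: g_def)
  next
    case False
    have "(\<lambda>n. a (n + k) * w ^ (n + k)) sums (h w - (\<Sum>i<k. a i * w ^ i))"
      using sums_h [of w] that by (intro sums_split_initial_segment) auto
    then have "(\<lambda>n. a (n + k) * w ^ (n + k) / w ^ k) sums (h w / w ^ k)"
      using a0 by (intro sums_divide) simp
    then show ?thesis using False by (simp add: g_def power_add)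
  qed
  have holo_g: "g holomorphic_on ball 0 1"
    using sums_g by (rule power_series_holomorphic)
  have *: "norm (g z) * r ^ k \<le> 1" if r: "norm z < r" "r < 1" for r
  proof -
    have rpos: "0 < r" using r norm_ge_zero [of z] by linarith
    have "norm (g z) \<le> 1 / r ^ k"
    proof (rule maximum_modulus_frontier [of g "cball 0 r"])
      show "g holomorphic_on interior (cball 0 r)"
        using r by (intro holomorphic_on_subset [OF holo_g]) auto
      show "continuous_on (closure (cball 0 r)) g"
        using r by (intro holomorphic_on_imp_continuous_on holomorphic_on_subset [OF holo_g]) auto
      fix w :: complex assume "w \<in> frontier (cball 0 r)"
      then have w: "norm w = r" using rpos by (simp add: frontier_cball)
      then have "norm (g w) * r ^ k \<le> 1"
        using bound [of w] h_eq [of w] r by (simp add: norm_mult norm_power mult.commute)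
      then show "norm (g w) \<le> 1 / r ^ k"
        using rpos by (simp add: field_simps)
    qed (use r in auto)
    then show ?thesis using rpos by (simp add: field_simps)
  qed
  have "((\<lambda>r. norm (g z) * r ^ k) \<longlongrightarrow> norm (g z) * 1 ^ k) (at_left (1::real))"
    by (intro tendsto_intros)
  moreover have "eventually (\<lambda>r. norm (g z) * r ^ k \<le> 1) (at_left (1::real))"
    using eventually_at_left_field [of "\<lambda>r. norm (g z) * r ^ k \<le> 1" 1] z * by blast
  ultimately have "norm (g z) * 1 ^ k \<le> 1"
    by (intro tendsto_upperbound) auto
  then show ?thesis
    using mult_right_mono [of "norm (g z)" 1 "norm z ^ k"] h_eq [OF z]
    by (simp add: norm_mult norm_power mult.commute)
qed

text \<open>Averaging over the \<open>k\<close>-th roots of unity keeps only the powers divisible by \<open>k\<close>.\<close>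

lemma root_average_sums:
  fixes a :: "nat \<Rightarrow> complex"
  assumes k: "0 < k" and z: "norm z < 1"
    and sums: "\<And>z. norm z < 1 \<Longrightarrow> (\<lambda>n. a n * z ^ n) sums h z"
  defines "\<zeta> \<equiv> cis (2 * pi / real k)"
  shows "(\<lambda>n. a (k * n) * (z ^ k) ^ n) sums ((\<Sum>j<k. h (\<zeta> ^ j * z)) / of_nat k)"
proof -
  have zeta_eq_1: "\<zeta> ^ n = 1 \<longleftrightarrow> k dvd n" for n
  proof -
    have "\<i> * of_real (real n * (2 * pi / real k)) = 2 * of_real pi * \<i> * of_nat n / of_nat k"
      by simp
    then have "\<zeta> ^ n = exp (2 * of_real pi * \<i> * of_nat n / of_nat k)"
      unfolding \<zeta>_def Complex.DeMoivre unfolding cis_conv_exp by (rule arg_cong)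
    then show ?thesis using complex_root_unity_eq_1 [of k n] k by simp
  qed
  then have zeta_1: "\<zeta> ^ k = 1" by simp
  have avg: "(\<Sum>j<k. (\<zeta> ^ j) ^ n) = (if k dvd n then of_nat k else 0)" for n
  proof -
    have "(\<Sum>j<k. (\<zeta> ^ j) ^ n) = (\<Sum>j<k. (\<zeta> ^ n) ^ j)"
      by (simp add: mult.commute flip: power_mult)
    also have "\<dots> = (if k dvd n then of_nat k else 0)"
    proof (cases "k dvd n")
      case True
      then show ?thesis using zeta_eq_1 [of n] by simp
    next
      case False
      then have "\<zeta> ^ n \<noteq> 1" using zeta_eq_1 by simp
      moreover have "(\<zeta> ^ n) ^ k = 1"
        by (metis mult.commute power_mult power_one zeta_1)
      ultimately show ?thesis using False by (simp add: geometric_sum)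
    qed
    finally show ?thesis .
  qed
  have "(\<lambda>n. \<Sum>j<k. a n * (\<zeta> ^ j * z) ^ n) sums (\<Sum>j<k. h (\<zeta> ^ j * z))"
    using z by (intro sums_sum sums) (simp add: norm_mult norm_power \<zeta>_def)
  then have "(\<lambda>n. (\<Sum>j<k. a n * (\<zeta> ^ j * z) ^ n) / of_nat k) sums
      ((\<Sum>j<k. h (\<zeta> ^ j * z)) / of_nat k)"
    by (rule sums_divide)
  moreover have "(\<Sum>j<k. a n * (\<zeta> ^ j * z) ^ n) / of_nat k = (if k dvd n then a n * z ^ n else 0)" for n
  proof -
    have "(\<Sum>j<k. a n * (\<zeta> ^ j * z) ^ n) = a n * z ^ n * (\<Sum>j<k. (\<zeta> ^ j) ^ n)"
      by (simp add: power_mult_distrib sum_distrib_left mult_ac)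
    then show ?thesis using k by (simp add: avg)
  qed
  ultimately have "(\<lambda>n. if k dvd n then a n * z ^ n else 0) sums
      ((\<Sum>j<k. h (\<zeta> ^ j * z)) / of_nat k)"
    by simp
  \<comment> \<open>Only multiples of \<open>k\<close> carry nonzero terms, so the series may be
    reindexed along \<open>k * n\<close>.\<close>
  then have "(\<lambda>n. if k dvd k * n then a (k * n) * z ^ (k * n) else 0) sums
      ((\<Sum>j<k. h (\<zeta> ^ j * z)) / of_nat k)"
    using k by (subst sums_mono_reindex [where g = "\<lambda>n. k * n"])
      (auto simp: strict_mono_def dvd_def image_iff)
  then show ?thesis by (simp add: power_mult)
qed

text \<open>A disc automorphism moves \<open>g 0\<close> to \<open>0\<close>, where the Schwarz
  lemma bounds the derivative by \<open>1\<close>. The derivative of the automorphism at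
  \<open>w = g 0\<close> is \<open>1 / (1 - norm w ^ 2)\<close>, so the chain rule gives the
  claim.\<close>

lemma Schwarz_Pick_deriv_0:
  assumes holo: "g holomorphic_on ball 0 1"
    and bound: "\<And>z. norm z < 1 \<Longrightarrow> norm (g z) < 1"
  shows "norm (deriv g 0) \<le> 1 - norm (g 0) ^ 2"
proof -
  define w where "w = g 0"
  have w: "norm w < 1" using bound [of 0] by (simp add: w_def)
  have ww: "cnj w * w = of_real (norm w ^ 2)"
    unfolding complex_norm_square by (rule mult.commute)
  have w2: "norm w ^ 2 < 1" using w by (simp add: power_less_one_iff)
  have nz: "1 - cnj w * w \<noteq> 0"
    using w2 by (metis ww eq_iff_diff_eq_0 less_irrefl of_real_eq_1_iff)
  define \<phi> where "\<phi> = Moebius_function 0 w \<circ> g"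
  have holo': "\<phi> holomorphic_on ball 0 1"
    unfolding \<phi>_def using bound
    by (intro holomorphic_on_compose_gen [OF holo Moebius_function_holomorphic [OF w]]) auto
  have "norm (deriv \<phi> 0) \<le> 1"
  proof (rule Schwarz_Lemma(2) [OF holo', of 0])
    show "\<phi> 0 = 0"
      by (simp add: \<phi>_def w_def Moebius_function_eq_zero)
    show "norm (\<phi> z) < 1" if "norm z < 1" for z
      unfolding \<phi>_def comp_def using w bound [OF that] by (rule Moebius_function_norm_lt_1)
  qed simp
  moreover have "(\<phi> has_field_derivative deriv g 0 / (1 - cnj w * w)) (at 0)"
  proof -
    have "(g has_field_derivative deriv g 0) (at 0)"
      using holo by (intro holomorphic_derivI) auto
    then show ?thesis
      unfolding \<phi>_def Moebius_function_simple comp_def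
      by (auto intro!: derivative_eq_intros simp: w_def [symmetric] nz) (use nz in \<open>simp add: field_simps\<close>)
  qed
  ultimately have "norm (deriv g 0) / norm (1 - cnj w * w) \<le> 1"
    by (metis DERIV_imp_deriv norm_divide)
  moreover have "norm (1 - cnj w * w) = 1 - norm w ^ 2"
    unfolding ww using w2
    by (metis abs_of_pos diff_gt_0_iff_gt norm_of_real of_real_1 of_real_diff)
  ultimately show ?thesis using w2 by (simp add: w_def divide_simps split: if_splits)
qed

text \<open>The average of \<open>h\<close> over rotations by the \<open>k\<close>-th roots of unity
  is a function of \<open>z ^ k\<close> in which the \<open>k\<close>-th coefficient of
  \<open>h\<close> has become the first. Averaging keeps the bound \<open>1\<close>, so the
  Schwarz-Pick estimate at the centre applies.\<close>

lemma coeff_bound_complex: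
  fixes a :: "nat \<Rightarrow> complex"
  assumes k: "0 < k"
    and sums: "\<And>z. norm z < 1 \<Longrightarrow> (\<lambda>n. a n * z ^ n) sums h z"
    and bound: "\<And>z. norm z < 1 \<Longrightarrow> norm (h z) < 1"
  shows "norm (a k) \<le> 1 - norm (a 0) ^ 2"
proof -
  define g where "g w = (\<Sum>n. a (k * n) * w ^ n)" for w
  have *: "(\<lambda>n. a (k * n) * w ^ n) sums g w \<and> norm (g w) < 1" if w: "norm w < 1" for w
  proof -
    \<comment> \<open>Any root will do: the average takes the same value at all of them.\<close>
    obtain z where z: "z ^ k = w"
      using k exists_complex_root [of k w] by auto
    have "norm z < 1"
    proof (rule ccontr)
      assume "\<not> norm z < 1"
      then have "1 \<le> norm z ^ k" by (intro one_le_power) simp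
      with w z show False by (metis norm_power not_less)
    qed
    define s where "s = (\<Sum>j<k. h (cis (2 * pi / real k) ^ j * z))"
    have "(\<lambda>n. a (k * n) * w ^ n) sums (s / of_nat k)"
      unfolding s_def z [symmetric] using k \<open>norm z < 1\<close> sums by (rule root_average_sums)
    moreover have "norm s < of_nat k"
    proof -
      have "norm s \<le> (\<Sum>j<k. norm (h (cis (2 * pi / real k) ^ j * z)))"
        unfolding s_def by (rule norm_sum)
      also have "\<dots> < (\<Sum>j<k. 1)"
        using k \<open>norm z < 1\<close>
        by (intro sum_strict_mono bound) (auto simp: norm_mult norm_power)
      finally show ?thesis by simp
    qed
    ultimately show ?thesis using k by (auto simp: g_def sums_iff norm_divide)
  qed
  have holo: "g holomorphic_on ball 0 1"
    by (rule power_series_holomorphic [where a = "\<lambda>n. a (k * n)"]) (use * in auto)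
  have "norm (deriv g 0) \<le> 1 - norm (g 0) ^ 2"
    using holo * by (intro Schwarz_Pick_deriv_0) auto
  moreover have "g 0 = a 0"
    using powser_sums_zero_iff [of "\<lambda>n. a (k * n)" "g 0"] * [of 0] by simp
  moreover have "deriv g 0 = a k"
  proof -
    \<comment> \<open>Convergence at \<open>1/2\<close> is enough to differentiate termwise at
      \<open>0\<close>.\<close>
    have "(g has_field_derivative (\<Sum>n. diffs (\<lambda>n. a (k * n)) n * 0 ^ n)) (at 0)"
      unfolding g_def
      by (rule termdiffs_strong [of _ "1/2"]) (use * [of "1/2"] in \<open>auto simp: sums_iff\<close>)
    then show ?thesis by (simp add: DERIV_imp_deriv diffs_def)
  qed
  ultimately show ?thesis by simp
qed

section \<open>Slices as copies of the complex plane\<close>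

lemma imag_unit_square: "I \<in> imag_units \<Longrightarrow> I * I = - 1"
  by (simp add: imag_units_def power2_eq_square)

definition slice_emb :: "quat \<Rightarrow> complex \<Rightarrow> quat" where
  "slice_emb I z = slice_pt I (Re z) (Im z)"

text \<open>
  Orthogonal projection onto the slice of \<open>I\<close>, read as a complex number. It is linear
  for left multiplication by the slice, so it turns slice regular functions into holomorphic ones.
\<close>

definition slice_proj :: "quat \<Rightarrow> quat \<Rightarrow> complex" where
  "slice_proj I q = Complex (qRe q) (qI I * qI q + qJ I * qJ q + qK I * qK q)"

lemma bounded_linear_slice_emb: "bounded_linear (slice_emb I)"
  unfolding slice_emb_def slice_pt_def of_real_def
  by (intro bounded_linear_intros bounded_linear_add bounded_linear_mult_const
      bounded_linear_scaleR_const bounded_linear_Re bounded_linear_Im)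

lemma bounded_linear_slice_proj: "bounded_linear (slice_proj I)"
proof -
  have "linear (slice_proj I)"
    by (rule linearI) (simp_all add: slice_proj_def complex_eq_iff algebra_simps)
  then show ?thesis by (rule linear_conv_bounded_linear [THEN iffD1])
qed

lemmas slice_proj_add = linear_add [OF bounded_linear.linear [OF bounded_linear_slice_proj]]
lemmas slice_proj_scaleR = linear_scale [OF bounded_linear.linear [OF bounded_linear_slice_proj]]

lemma slice_emb_of_real: "slice_emb I (of_real a) = of_real a"
  by (simp add: slice_emb_def slice_pt_def)

lemma slice_emb_0: "slice_emb I 0 = 0"
  by (simp add: slice_emb_def slice_pt_def)

lemma slice_proj_0: "slice_proj I 0 = 0"
  by (simp add: slice_proj_def complex_eq_iff)

lemma slice_emb_1: "slice_emb I 1 = 1"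
  using slice_emb_of_real [of I 1] by simp

lemma slice_emb_ii: "slice_emb I \<i> = I"
  by (simp add: slice_emb_def slice_pt_def)

lemma slice_emb_mult:
  assumes "I \<in> imag_units"
  shows "slice_emb I (z * w) = slice_emb I z * slice_emb I w"
proof -
  have "I * I = - 1" using assms by (rule imag_unit_square)
  moreover have "slice_emb I z * slice_emb I w =
      of_real (Re z * Re w) + of_real (Im z * Im w) * (I * I) + of_real (Re z * Im w + Im z * Re w) * I"
    by (simp add: slice_emb_def slice_pt_def quat_eq_iff algebra_simps)
  ultimately have "slice_emb I z * slice_emb I w =
      of_real (Re z * Re w) + of_real (Im z * Im w) * (- 1) + of_real (Re z * Im w + Im z * Re w) * I"
    by (simp only:)
  then show ?thesis
    by (simp add: slice_emb_def slice_pt_def)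
qed

lemma slice_emb_power:
  assumes "I \<in> imag_units"
  shows "slice_emb I (z ^ n) = slice_emb I z ^ n"
  using assms by (induction n) (simp_all add: slice_emb_1 slice_emb_mult)

lemma slice_proj_ii_mult:
  assumes "I \<in> imag_units"
  shows "slice_proj I (I * q) = \<i> * slice_proj I q"
proof -
  have re: "qRe I = 0" and n: "(qI I)\<^sup>2 + (qJ I)\<^sup>2 + (qK I)\<^sup>2 = 1"
    using assms by (auto simp: imag_units_iff)
  have "Im (slice_proj I (I * q)) = ((qI I)\<^sup>2 + (qJ I)\<^sup>2 + (qK I)\<^sup>2) * qRe q"
    using re by (simp add: slice_proj_def algebra_simps power2_eq_square)
  then show ?thesis
    using re by (simp add: n complex_eq_iff) (simp add: slice_proj_def)
qed

lemma slice_proj_emb_mult: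
  assumes "I \<in> imag_units"
  shows "slice_proj I (slice_emb I z * q) = z * slice_proj I q"
proof -
  have "slice_emb I z * q = Re z *\<^sub>R q + Im z *\<^sub>R (I * q)"
    by (simp add: slice_emb_def slice_pt_def distrib_right scaleR_conv_of_real mult.assoc)
  then show ?thesis
    using assms by (simp add: slice_proj_add slice_proj_scaleR slice_proj_ii_mult
        complex_eq_iff)
qed

lemma slice_proj_1: "slice_proj I 1 = 1"
  by (simp add: slice_proj_def complex_eq_iff)

lemma slice_proj_emb:
  assumes "I \<in> imag_units"
  shows "slice_proj I (slice_emb I z) = z"
  using slice_proj_emb_mult [OF assms, of z 1] by (simp add: slice_proj_1)

lemma norm_slice_emb:
  assumes "I \<in> imag_units"
  shows "norm (slice_emb I z) = norm z"
proof -
  have re: "qRe I = 0" and n: "(qI I)\<^sup>2 + (qJ I)\<^sup>2 + (qK I)\<^sup>2 = 1"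
    using assms by (auto simp: imag_units_iff)
  have "(qRe (slice_emb I z))\<^sup>2 + (qI (slice_emb I z))\<^sup>2 + (qJ (slice_emb I z))\<^sup>2 + (qK (slice_emb I z))\<^sup>2
      = (Re z)\<^sup>2 + (Im z)\<^sup>2 * ((qI I)\<^sup>2 + (qJ I)\<^sup>2 + (qK I)\<^sup>2)"
    using re by (simp add: slice_emb_def slice_pt_def power_mult_distrib algebra_simps)
  then show ?thesis by (simp add: n norm_quat_def cmod_def)
qed

text \<open>Cauchy--Schwarz, in the form of Lagrange's identity.\<close>

lemma norm_slice_proj_le:
  assumes "I \<in> imag_units"
  shows "norm (slice_proj I q) \<le> norm q"
proof -
  define a b c x y z where "a = qI I" and "b = qJ I" and "c = qK I"
    and "x = qI q" and "y = qJ q" and "z = qK q"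
  have n: "a\<^sup>2 + b\<^sup>2 + c\<^sup>2 = 1"
    using assms by (auto simp: imag_units_iff a_def b_def c_def)
  have "x\<^sup>2 + y\<^sup>2 + z\<^sup>2 = (a\<^sup>2 + b\<^sup>2 + c\<^sup>2) * (x\<^sup>2 + y\<^sup>2 + z\<^sup>2)"
    by (simp add: n)
  also have "\<dots> = (a * x + b * y + c * z)\<^sup>2 + (a * y - b * x)\<^sup>2 + (a * z - c * x)\<^sup>2 + (b * z - c * y)\<^sup>2"
    by (simp add: power2_eq_square algebra_simps)
  finally have "(a * x + b * y + c * z)\<^sup>2 \<le> x\<^sup>2 + y\<^sup>2 + z\<^sup>2"
    by simp
  then show ?thesis
    by (simp add: norm_quat_def cmod_def slice_proj_def a_def b_def c_def x_def y_def z_def)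
qed

lemma slice_emb_surj:
  obtains I z where "I \<in> imag_units" "q = slice_emb I z"
proof -
  define s where "s = sqrt ((qI q)\<^sup>2 + (qJ q)\<^sup>2 + (qK q)\<^sup>2)"
  have s2: "s\<^sup>2 = (qI q)\<^sup>2 + (qJ q)\<^sup>2 + (qK q)\<^sup>2"
    by (simp add: s_def)
  show thesis
  proof (cases "s = 0")
    case True
    then have "(qI q)\<^sup>2 + (qJ q)\<^sup>2 + (qK q)\<^sup>2 = 0" using s2 by simp
    then have "qI q = 0 \<and> qJ q = 0 \<and> qK q = 0"
      by (simp add: add_nonneg_eq_0_iff)
    \<comment> \<open>A real quaternion lies in every slice, so the choice of the unit is
      free.\<close>
    then show thesis
      by (intro that [of "Quat 0 1 0 0" "Complex (qRe q) 0"])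
        (simp_all add: imag_units_iff slice_emb_def slice_pt_def quat_eq_iff)
  next
    case False
    have "(qI q / s)\<^sup>2 + (qJ q / s)\<^sup>2 + (qK q / s)\<^sup>2 = 1"
      using False by (simp add: power_divide s2 [symmetric] flip: add_divide_distrib)
    then show thesis
      using False
      by (intro that [of "Quat 0 (qI q / s) (qJ q / s) (qK q / s)" "Complex (qRe q) s"])
        (simp_all add: imag_units_iff slice_emb_def slice_pt_def quat_eq_iff)
  qed
qed

text \<open>
  One projection loses two real coordinates. The projections of \<open>q * c\<close>, for \<open>c\<close>
  in the standard basis, determine \<open>q\<close>, because the sum of \<open>cnj c * I * c\<close> vanishes.
\<close>

definition quat_units :: "quat set" where
  "quat_units = {1, Quat 0 1 0 0, Quat 0 0 1 0, Quat 0 0 0 1}"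

lemma slice_proj_reconstruct:
  assumes "I \<in> imag_units"
  shows "q = (1/2) *\<^sub>R (\<Sum>c\<in>quat_units. slice_emb I (slice_proj I (q * c)) * inverse c)"
proof -
  have re: "qRe I = 0" and n: "(qI I)\<^sup>2 + (qJ I)\<^sup>2 + (qK I)\<^sup>2 = 1"
    using assms by (auto simp: imag_units_iff)
  have ne: "1 \<noteq> Quat 0 1 0 0" "1 \<noteq> Quat 0 0 1 0" "1 \<noteq> Quat 0 0 0 1"
    by (simp_all add: quat_eq_iff)
  have inv: "inverse (Quat 0 1 0 0) = Quat 0 (-1) 0 0" "inverse (Quat 0 0 1 0) = Quat 0 0 (-1) 0"
      "inverse (Quat 0 0 0 1) = Quat 0 0 0 (-1)"
    by (simp_all add: inverse_quat_def norm_quat_def quat_eq_iff)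
  define S where "S = (\<Sum>c\<in>quat_units. slice_emb I (slice_proj I (q * c)) * inverse c)"
  have S: "S = slice_emb I (slice_proj I q)
      + (slice_emb I (slice_proj I (q * Quat 0 1 0 0)) * Quat 0 (-1) 0 0
      + (slice_emb I (slice_proj I (q * Quat 0 0 1 0)) * Quat 0 0 (-1) 0
      + slice_emb I (slice_proj I (q * Quat 0 0 0 1)) * Quat 0 0 0 (-1)))"
    unfolding S_def quat_units_def using ne by (simp add: inv)
  \<comment> \<open>The squared norm of \<open>I\<close> stays symbolic so that each coordinate is a
    polynomial identity; setting it to \<open>1\<close> gives \<open>S = 2 q\<close>, which explains
    the factor \<open>1/2\<close>.\<close>
  let ?n = "(qI I)\<^sup>2 + (qJ I)\<^sup>2 + (qK I)\<^sup>2"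
  have "qRe S = qRe q + ?n * qRe q" "qI S = qI q + ?n * qI q"
      "qJ S = qJ q + ?n * qJ q" "qK S = qK q + ?n * qK q"
    unfolding S by (simp_all add: slice_emb_def slice_pt_def slice_proj_def re
        power2_eq_square algebra_simps)
  then show ?thesis
    unfolding n S_def [symmetric] by (simp add: quat_eq_iff)
qed

lemma slice_proj_eqI:
  assumes "I \<in> imag_units" and "\<And>c. slice_proj I (q * c) = slice_proj I (r * c)"
  shows "q = r"
  by (subst (1 2) slice_proj_reconstruct [OF assms(1)]) (simp add: assms(2))

section \<open>Slice regularity and holomorphy\<close>

definition slice_fun :: "quat \<Rightarrow> quat \<Rightarrow> (quat \<Rightarrow> quat) \<Rightarrow> complex \<Rightarrow> complex" where
  "slice_fun I c f z = slice_proj I (f (slice_emb I z) * c)"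

lemma bounded_linear_slice_proj_mult: "bounded_linear (\<lambda>q. slice_proj I (q * c))"
  by (intro bounded_linear_compose [OF bounded_linear_slice_proj] bounded_linear_mult_left)

lemma open_slice_disc: "open {(x, y). slice_pt I x y \<in> ball 0 1}"
proof -
  have "continuous_on UNIV (\<lambda>p. slice_pt I (fst p) (snd p))"
    unfolding slice_pt_def by (intro continuous_intros)
  then have "open ((\<lambda>p. slice_pt I (fst p) (snd p)) -` ball 0 1)"
    by (intro open_vimage) auto
  also have "(\<lambda>p. slice_pt I (fst p) (snd p)) -` ball 0 1 = {(x, y). slice_pt I x y \<in> ball 0 1}"
    by auto
  finally show ?thesis .
qed

lemma slice_regular_slice_dx:
  assumes "slice_regular f" and "I \<in> imag_units" and "slice_pt I x y \<in> ball 0 1"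
  shows "((\<lambda>t. f (slice_pt I t y)) has_vector_derivative slice_dx I f x y) (at x)"
  using assms unfolding slice_regular_def slice_dx_def
  by (simp flip: vector_derivative_works)

lemma slice_regular_slice_dy:
  assumes "slice_regular f" and "I \<in> imag_units" and "slice_pt I x y \<in> ball 0 1"
  shows "((\<lambda>t. f (slice_pt I x t)) has_vector_derivative slice_dy I f x y) (at y)"
  using assms unfolding slice_regular_def slice_dy_def
  by (simp flip: vector_derivative_works)

lemma slice_regular_dy_eq:
  assumes "slice_regular f" and "I \<in> imag_units" and "slice_pt I x y \<in> ball 0 1"
  shows "slice_dy I f x y = I * slice_dx I f x y"
proof -
  have "(1/2) *\<^sub>R (slice_dx I f x y + I * slice_dy I f x y) = 0"
    using assms unfolding slice_regular_def by blast
  then have "slice_dx I f x y = - (I * slice_dy I f x y)"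
    by (simp only: scaleR_eq_0_iff add_eq_0_iff2) simp
  moreover have "I * I = - 1"
    using assms(2) by (rule imag_unit_square)
  ultimately show ?thesis
    by (simp flip: mult.assoc)
qed

text \<open>Continuous partial derivatives give a real total derivative, and the Cauchy-Riemann
  equation, pushed through the left-linear projection, makes it multiplication by a complex number.
  Naming that number through \<open>slice_deriv\<close> prepares the iteration.\<close>

lemma slice_fun_has_field_derivative:
  assumes f: "slice_regular f" and I: "I \<in> imag_units" and z: "z \<in> ball 0 1"
  shows "(slice_fun I c f has_field_derivative slice_fun I c (slice_deriv f) z) (at z)"
proof -
  define D where "D = {(x, y). slice_pt I x y \<in> ball 0 1}"
  define L where "L q = slice_proj I (q * c)" for q
  define x y where "x = Re z" and "y = Im z"
  have L: "bounded_linear L"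
    unfolding L_def by (rule bounded_linear_slice_proj_mult)
  have "open D" unfolding D_def by (rule open_slice_disc)
  have xy: "(x, y) \<in> D" "slice_pt I x y \<in> ball 0 1"
    using z norm_slice_emb [OF I, of z] by (simp_all add: D_def x_def y_def slice_emb_def)
  obtain X Y' where XY': "open X" "open Y'" "(x, y) \<in> X \<times> Y'" "X \<times> Y' \<subseteq> D"
    using open_prod_elim [OF \<open>open D\<close> xy(1)] by blast
  \<comment> \<open>The criterion by partial derivatives asks for a convex second factor, so
    \<open>Y'\<close> is shrunk to a ball.\<close>
  obtain e where e: "0 < e" "ball y e \<subseteq> Y'"
    using XY' open_contains_ball by blast
  define Y where "Y = ball y e"
  have XY: "open X" "open Y" "convex Y" "x \<in> X" "y \<in> Y" "X \<times> Y \<subseteq> D"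
    using XY' e by (auto simp: Y_def)
  have "((\<lambda>(x, y). L (f (slice_pt I x y))) has_derivative
      (\<lambda>(tx, ty). tx *\<^sub>R L (slice_dx I f x y) + blinfun_scaleR_left (L (slice_dy I f x y)) ty))
      (at (x, y) within X \<times> Y)"
  proof (rule has_derivative_partialsI)
    have "((\<lambda>t. L (f (slice_pt I t y))) has_vector_derivative L (slice_dx I f x y)) (at x)"
      by (rule bounded_linear.has_vector_derivative [OF L slice_regular_slice_dx [OF f I xy(2)]])
    then show "((\<lambda>t. L (f (slice_pt I t y))) has_derivative (\<lambda>t. t *\<^sub>R L (slice_dx I f x y))) (at x within X)"
      unfolding has_vector_derivative_def by (rule has_derivative_at_withinI)
  next
    fix x' y' assume "x' \<in> X" "y' \<in> Y"
    with XY have "slice_pt I x' y' \<in> ball 0 1" by (auto simp: D_def)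
    then have "((\<lambda>t. L (f (slice_pt I x' t))) has_vector_derivative L (slice_dy I f x' y')) (at y')"
      by (intro bounded_linear.has_vector_derivative [OF L slice_regular_slice_dy [OF f I]])
    then show "((\<lambda>t. L (f (slice_pt I x' t))) has_derivative
        blinfun_apply (blinfun_scaleR_left (L (slice_dy I f x' y')))) (at y' within Y)"
      unfolding has_vector_derivative_def blinfun_scaleR_left.rep_eq
      by (rule has_derivative_at_withinI)
  next
    have "continuous_on D (\<lambda>(x, y). slice_dy I f x y)"
      using f I unfolding slice_regular_def D_def by blast
    then have "continuous_on D (\<lambda>p. blinfun_scaleR_left (L (case p of (x, y) \<Rightarrow> slice_dy I f x y)))"
      by (intro bounded_linear.continuous_on [OF bounded_linear_blinfun_scaleR_left]
          bounded_linear.continuous_on [OF L])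
    then have "continuous_on (X \<times> Y) (\<lambda>p. blinfun_scaleR_left (L (case p of (x, y) \<Rightarrow> slice_dy I f x y)))"
      by (rule continuous_on_subset [OF _ XY(6)])
    then show "continuous (at (x, y) within X \<times> Y)
        (\<lambda>(x, y). blinfun_scaleR_left (L (slice_dy I f x y)))"
      using XY by (simp add: continuous_on_eq_continuous_within case_prod_unfold)
  qed (use XY in auto)
  moreover have "at (x, y) within X \<times> Y = at (x, y)"
    using XY by (intro at_within_open open_Times) auto
  ultimately have "((\<lambda>(x, y). L (f (slice_pt I x y))) has_derivative
      (\<lambda>(tx, ty). tx *\<^sub>R L (slice_dx I f x y) + ty *\<^sub>R L (slice_dy I f x y))) (at (x, y))"
    by simp
  then have "((\<lambda>(x, y). L (f (slice_pt I x y))) has_derivative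
      (\<lambda>(tx, ty). tx *\<^sub>R L (slice_dx I f x y) + ty *\<^sub>R L (slice_dy I f x y))) (at (Re z, Im z))"
    by (simp add: x_def y_def)
  then have "((\<lambda>w. case (Re w, Im w) of (x, y) \<Rightarrow> L (f (slice_pt I x y))) has_derivative
      (\<lambda>w. case (Re w, Im w) of (tx, ty) \<Rightarrow> tx *\<^sub>R L (slice_dx I f x y) + ty *\<^sub>R L (slice_dy I f x y))) (at z)"
    by (rule has_derivative_compose [rotated]) (auto intro!: derivative_eq_intros)
  then have "((\<lambda>w. L (f (slice_emb I w))) has_derivative
      (\<lambda>w. Re w *\<^sub>R L (slice_dx I f x y) + Im w *\<^sub>R L (slice_dy I f x y))) (at z)"
    by (simp add: slice_emb_def)
  \<comment> \<open>By the Cauchy-Riemann equation both halves of the slice derivative agree,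
    leaving the partial derivative in \<open>x\<close>.\<close>
  moreover have "slice_deriv f (slice_emb I z) = slice_dx I f x y"
  proof -
    have "I * I = - 1" using I by (rule imag_unit_square)
    then have "I * slice_dy I f x y = - slice_dx I f x y"
      by (simp add: slice_regular_dy_eq [OF f I xy(2)] flip: mult.assoc)
    then have "slice_deriv f (slice_pt I x y) = (1/2) *\<^sub>R (slice_dx I f x y + slice_dx I f x y)"
      by (simp add: slice_deriv_eq [OF f I xy(2)])
    then show ?thesis
      by (simp add: slice_emb_def x_def y_def scaleR_2 [symmetric])
  qed
  moreover have "L (slice_dy I f x y) = \<i> * L (slice_dx I f x y)"
    unfolding slice_regular_dy_eq [OF f I xy(2)] L_def mult.assoc
    by (rule slice_proj_ii_mult [OF I])
  moreover have "Re w *\<^sub>R l + Im w *\<^sub>R (\<i> * l) = l * w" for l w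
    by (simp add: complex_eq_iff algebra_simps)
  ultimately show ?thesis
    by (simp add: has_field_derivative_def slice_fun_def [abs_def] L_def)
qed

lemma slice_fun_holomorphic:
  assumes "slice_regular f" and "I \<in> imag_units"
  shows "slice_fun I c f holomorphic_on ball 0 1"
  using slice_fun_has_field_derivative [OF assms]
  by (intro holomorphic_onI) (meson field_differentiable_at_within field_differentiable_def)

text \<open>On each slice \<open>f\<close> is a fixed real-linear combination of finitely many slice
  functions, so smoothness passes from these to \<open>f\<close>. The Cauchy-Riemann equation
  follows because this combination turns \<open>\<i>\<close> into \<open>I\<close>.\<close>

lemma slice_regularI:
  assumes holo: "\<And>I c. I \<in> imag_units \<Longrightarrow> slice_fun I c f holomorphic_on ball 0 1"
  shows "slice_regular f"
  unfolding slice_regular_def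
proof (intro ballI)
  fix I assume I: "I \<in> imag_units"
  \<comment> \<open>\<open>T\<close> is the reconstruction formula, read as acting on families of
    complex numbers indexed by the multipliers \<open>c\<close>.\<close>
  define T where "T w = (1/2) *\<^sub>R (\<Sum>c\<in>quat_units. slice_emb I (w c) * inverse c)" for w
  define d where "d x y = T (\<lambda>c. deriv (slice_fun I c f) (Complex x y))" for x y
  have f_eq: "f (slice_emb I z) = T (\<lambda>c. slice_fun I c f z)" for z
    unfolding T_def slice_fun_def by (rule slice_proj_reconstruct [OF I])
  have T_ii: "T (\<lambda>c. \<i> * w c) = I * T w" for w
    by (simp add: T_def slice_emb_mult [OF I] slice_emb_ii sum_distrib_left mult.assoc)
  have disc: "Complex x y \<in> ball 0 1 \<longleftrightarrow> slice_pt I x y \<in> ball 0 1" for x y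
    using norm_slice_emb [OF I, of "Complex x y"] by (simp add: slice_emb_def)
  have chain: "((\<lambda>t. f (slice_emb I (\<gamma> t))) has_vector_derivative
      T (\<lambda>c. \<gamma>' * deriv (slice_fun I c f) (\<gamma> s))) (at s)"
    if \<gamma>: "(\<gamma> has_vector_derivative \<gamma>') (at s)" "\<gamma> s \<in> ball 0 1" for \<gamma> \<gamma>' s
  proof -
    have "((\<lambda>t. slice_fun I c f (\<gamma> t)) has_vector_derivative \<gamma>' * deriv (slice_fun I c f) (\<gamma> s)) (at s)" for c
    proof -
      have "(slice_fun I c f has_field_derivative deriv (slice_fun I c f) (\<gamma> s)) (at (\<gamma> s))"
        using holo [OF I] \<gamma>(2) by (intro holomorphic_derivI) auto
      from field_vector_diff_chain_at [OF \<gamma>(1) this] show ?thesis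
        by (simp add: o_def)
    qed
    then show ?thesis
      unfolding f_eq T_def
      by (intro bounded_linear.has_vector_derivative [OF bounded_linear_scaleR_right]
          has_vector_derivative_sum
          bounded_linear.has_vector_derivative [OF bounded_linear_mult_left]
          bounded_linear.has_vector_derivative [OF bounded_linear_slice_emb])
  qed
  have dx: "((\<lambda>t. f (slice_pt I t y)) has_vector_derivative d x y) (at x)"
    and dy: "((\<lambda>t. f (slice_pt I x t)) has_vector_derivative I * d x y) (at y)"
    if "slice_pt I x y \<in> ball 0 1" for x y
  proof -
    have "((\<lambda>t. Complex t y) has_vector_derivative 1) (at x)"
      "((\<lambda>t. Complex x t) has_vector_derivative \<i>) (at y)"
      unfolding Complex_eq by (auto intro!: derivative_eq_intros)
    from chain [OF this(1)] chain [OF this(2)] that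
    show "((\<lambda>t. f (slice_pt I t y)) has_vector_derivative d x y) (at x)"
      "((\<lambda>t. f (slice_pt I x t)) has_vector_derivative I * d x y) (at y)"
      unfolding disc T_ii d_def by (simp_all add: slice_emb_def)
  qed
  have dx_eq: "slice_dx I f x y = d x y" and dy_eq: "slice_dy I f x y = I * d x y"
    if "slice_pt I x y \<in> ball 0 1" for x y
    unfolding slice_dx_def slice_dy_def using dx [OF that] dy [OF that]
    by (simp_all add: vector_derivative_at)
  have cont: "continuous_on {(x, y). slice_pt I x y \<in> ball 0 1} (\<lambda>(x, y). d x y)"
  proof -
    have "continuous_on {(x, y). slice_pt I x y \<in> ball 0 1}
        (\<lambda>p. deriv (slice_fun I c f) (Complex (fst p) (snd p)))" for c
    proof (rule continuous_on_compose2 [of "ball 0 1" "deriv (slice_fun I c f)"])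
      show "continuous_on (ball 0 1) (deriv (slice_fun I c f))"
        using holo [OF I] by (intro holomorphic_on_imp_continuous_on holomorphic_deriv) auto
      show "continuous_on {(x, y). slice_pt I x y \<in> ball 0 1} (\<lambda>p. Complex (fst p) (snd p))"
        unfolding Complex_eq by (intro continuous_intros)
      show "(\<lambda>p. Complex (fst p) (snd p)) ` {(x, y). slice_pt I x y \<in> ball 0 1} \<subseteq> ball 0 1"
        using disc by auto
    qed
    then show ?thesis
      unfolding d_def T_def case_prod_unfold
      by (intro continuous_intros bounded_linear.continuous_on [OF bounded_linear_slice_emb])
  qed
  have "I * I = - 1" using I by (rule imag_unit_square)
  then have "slice_dx I f x y + I * slice_dy I f x y = 0" if "slice_pt I x y \<in> ball 0 1" for x y
    using that by (simp add: dx_eq dy_eq flip: mult.assoc)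
  moreover have "continuous_on {(x, y). slice_pt I x y \<in> ball 0 1} (\<lambda>(x, y). slice_dx I f x y)"
    using cont by (rule continuous_on_eq) (auto simp: dx_eq)
  moreover have "continuous_on {(x, y). slice_pt I x y \<in> ball 0 1} (\<lambda>(x, y). slice_dy I f x y)"
  proof (rule continuous_on_eq)
    show "continuous_on {(x, y). slice_pt I x y \<in> ball 0 1} (\<lambda>p. I * (case p of (x, y) \<Rightarrow> d x y))"
      by (intro continuous_intros cont)
  qed (auto simp: dy_eq)
  ultimately show "(\<forall>x y. slice_pt I x y \<in> ball 0 1 \<longrightarrow>
        (\<lambda>t. f (slice_pt I t y)) differentiable at x \<and>
        (\<lambda>t. f (slice_pt I x t)) differentiable at y \<and>
        (1/2) *\<^sub>R (slice_dx I f x y + I * slice_dy I f x y) = 0) \<and>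
      continuous_on {(x, y). slice_pt I x y \<in> ball 0 1} (\<lambda>(x, y). slice_dx I f x y) \<and>
      continuous_on {(x, y). slice_pt I x y \<in> ball 0 1} (\<lambda>(x, y). slice_dy I f x y)"
    using differentiableI_vector [OF dx] differentiableI_vector [OF dy] by auto
qed

lemma slice_fun_slice_deriv:
  assumes "slice_regular f" and "I \<in> imag_units" and "z \<in> ball 0 1"
  shows "slice_fun I c (slice_deriv f) z = deriv (slice_fun I c f) z"
  using DERIV_imp_deriv [OF slice_fun_has_field_derivative [OF assms]] by (rule sym)

text \<open>This lets the derivative formula be applied again to the iterates of
  \<open>slice_deriv\<close>.\<close>

lemma slice_regular_slice_deriv:
  assumes "slice_regular f"
  shows "slice_regular (slice_deriv f)"
proof (rule slice_regularI)
  fix I c assume I: "I \<in> imag_units"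
  have "deriv (slice_fun I c f) holomorphic_on ball 0 1"
    using slice_fun_holomorphic [OF assms I] by (rule holomorphic_deriv) simp
  then show "slice_fun I c (slice_deriv f) holomorphic_on ball 0 1"
    by (rule holomorphic_transform) (simp add: slice_fun_slice_deriv [OF assms I])
qed

lemma slice_fun_iterated_slice_deriv:
  assumes f: "slice_regular f" and I: "I \<in> imag_units" and "z \<in> ball 0 1"
  shows "slice_fun I c ((slice_deriv ^^ n) f) z = (deriv ^^ n) (slice_fun I c f) z"
  using \<open>z \<in> ball 0 1\<close>
proof (induction n arbitrary: z)
  case (Suc n)
  have "slice_regular ((slice_deriv ^^ n) f)"
    using f by (induction n) (auto intro: slice_regular_slice_deriv)
  then have "slice_fun I c ((slice_deriv ^^ Suc n) f) z = deriv (slice_fun I c ((slice_deriv ^^ n) f)) z"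
    using I Suc.prems by (simp add: slice_fun_slice_deriv)
  also have "\<dots> = deriv ((deriv ^^ n) (slice_fun I c f)) z"
  proof (rule deriv_cong_ev)
    have "eventually (\<lambda>w. w \<in> ball 0 1) (nhds z)"
      using Suc.prems by (intro eventually_nhds_in_open) auto
    then show "eventually (\<lambda>w. slice_fun I c ((slice_deriv ^^ n) f) w = (deriv ^^ n) (slice_fun I c f) w) (nhds z)"
      by eventually_elim (rule Suc.IH)
  qed simp
  finally show ?case by simp
qed simp

section \<open>Coefficient and growth estimates\<close>

text \<open>Multiplying on the right commutes with the left action of every slice, so a value can be
  made real without disturbing regularity.\<close>

lemma unit_multiplier_exists:
  fixes v :: quat
  obtains c where "norm c = 1" "v * c = of_real (norm v)"
proof (cases "v = 0")
  case True
  then show thesis by (intro that [of 1]) auto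
next
  case False
  then show thesis
    by (intro that [of "inverse v * of_real (norm v)"])
      (simp_all add: norm_mult norm_inverse flip: mult.assoc)
qed

lemma norm_slice_fun_less:
  assumes "f \<in> SB" and "I \<in> imag_units" and "norm c = 1" and "norm z \<le> 1"
  shows "norm (slice_fun I c f z) < 1"
proof -
  have "norm (slice_fun I c f z) \<le> norm (f (slice_emb I z))"
    using norm_slice_proj_le [OF assms(2), of "f (slice_emb I z) * c"] assms(3)
    by (simp add: slice_fun_def norm_mult)
  also have "\<dots> < 1"
    using assms by (simp add: SB_def norm_slice_emb)
  finally show ?thesis .
qed

text \<open>The slice passes through \<open>q\<close> and the multiplier makes
  \<open>\<omega> q\<close> real, so projecting costs no modulus at this one point. The zero at the
  origin is inherited by the slice function, and the complex Schwarz lemma of order \<open>k\<close>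
  finishes.\<close>

lemma SBn_Schwarz:
  assumes \<omega>: "\<omega> \<in> SBn k" and q: "norm q < 1"
  shows "norm (\<omega> q) \<le> norm q ^ k"
proof -
  obtain I z where I: "I \<in> imag_units" and q_eq: "q = slice_emb I z"
    by (rule slice_emb_surj)
  obtain c where c: "norm c = 1" "\<omega> q * c = of_real (norm (\<omega> q))"
    by (rule unit_multiplier_exists)
  have z: "norm z = norm q" by (simp add: q_eq norm_slice_emb [OF I])
  have SB: "\<omega> \<in> SB" and reg: "slice_regular \<omega>"
    using \<omega> by (simp_all add: SBn_def SB_def)
  have "norm (slice_fun I c \<omega> z) \<le> norm z ^ k"
  proof (rule Schwarz_lemma_order)
    show "slice_fun I c \<omega> holomorphic_on ball 0 1"
      by (rule slice_fun_holomorphic [OF reg I])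
    show "norm (slice_fun I c \<omega> w) \<le> 1" if "norm w < 1" for w
      using norm_slice_fun_less [OF SB I c(1), of w] that by simp
    show "(deriv ^^ j) (slice_fun I c \<omega>) 0 = 0" if "j < k" for j
    proof -
      have "(deriv ^^ j) (slice_fun I c \<omega>) 0 = slice_fun I c ((slice_deriv ^^ j) \<omega>) 0"
        by (simp add: slice_fun_iterated_slice_deriv [OF reg I])
      also have "\<dots> = 0"
        using \<omega> that by (simp add: slice_fun_def slice_emb_0 slice_proj_0 SBn_def)
      finally show ?thesis .
    qed
  qed (use q z in simp)
  moreover have "slice_fun I c \<omega> z = of_real (norm (\<omega> q))"
    unfolding slice_fun_def q_eq [symmetric] c(2)
    by (metis slice_emb_of_real slice_proj_emb [OF I])
  ultimately show ?thesis by (simp add: z)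
qed

text \<open>
  The slice is chosen through the normalized coefficient \<open>p k\<close>, so that neither \<open>p 0\<close>
  nor \<open>p k\<close> loses norm under the projection.
\<close>

lemma SB_coeff_bound:
  assumes f: "f \<in> SB" and p: "has_slice_expansion f p" and k: "0 < k"
  shows "norm (p k) \<le> 1 - norm (p 0) ^ 2"
proof -
  obtain c where c: "norm c = 1" "p 0 * c = of_real (norm (p 0))"
    by (rule unit_multiplier_exists)
  obtain I w where I: "I \<in> imag_units" and w: "p k * c = slice_emb I w"
    by (rule slice_emb_surj)
  define a where "a n = slice_proj I (p n * c)" for n
  have "norm (a k) \<le> 1 - norm (a 0) ^ 2"
  proof (rule coeff_bound_complex [OF k])
    fix z :: complex assume z: "norm z < 1"
    then have "(\<lambda>n. slice_emb I z ^ n * p n) sums f (slice_emb I z)"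
      using p by (simp add: has_slice_expansion_def norm_slice_emb [OF I])
    then have "(\<lambda>n. slice_proj I (slice_emb I z ^ n * p n * c)) sums slice_fun I c f z"
      unfolding slice_fun_def by (rule bounded_linear.sums [OF bounded_linear_slice_proj_mult])
    moreover have "slice_proj I (slice_emb I z ^ n * p n * c) = a n * z ^ n" for n
      using slice_proj_emb_mult [OF I, of "z ^ n" "p n * c"]
      by (simp add: a_def slice_emb_power [OF I] mult.assoc mult.commute)
    ultimately show "(\<lambda>n. a n * z ^ n) sums slice_fun I c f z" by simp
    show "norm (slice_fun I c f z) < 1"
      using norm_slice_fun_less [OF f I c(1)] z by simp
  qed
  moreover have "a 0 = of_real (norm (p 0))"
    unfolding a_def c(2) by (metis slice_emb_of_real slice_proj_emb [OF I])
  moreover have "norm (a k) = norm (p k)"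
  proof -
    have "norm (a k) = norm (p k * c)"
      by (simp add: a_def w slice_proj_emb [OF I] norm_slice_emb [OF I])
    then show ?thesis by (simp add: norm_mult c(1))
  qed
  ultimately show ?thesis by simp
qed

section \<open>The Bohr inequality\<close>

text \<open>The concave function \<open>t powr (m / 2)\<close> lies below its tangent at
  \<open>t = 1\<close>; concavity is where \<open>m \<le> 2\<close> enters. This is Young's
  inequality with second factor \<open>1\<close>, applied to a positive base, so
  \<open>a = 0\<close> is treated apart.\<close>

lemma powr_Bernoulli:
  fixes a m :: real
  assumes "0 \<le> a" "0 < m" "m \<le> 2"
  shows "a powr m + (m / 2) * (1 - a\<^sup>2) \<le> 1"
proof (cases "a = 0")
  case False
  then have a: "0 < a" using assms by simp
  have "(a\<^sup>2) powr (m / 2) * 1 powr (1 - m / 2) \<le> (m / 2) * a\<^sup>2 + (1 - m / 2) * 1"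
    using assms a by (intro Youngs_inequality_0) auto
  moreover have "(a\<^sup>2) powr (m / 2) = a powr m"
    using a by (simp add: powr_powr flip: powr_numeral)
  ultimately show ?thesis by (simp add: algebra_simps)
qed (use assms in simp)

lemma SB_bohr_ineq:
  assumes m: "0 < m" "m \<le> 2" and f: "f \<in> SB" "has_slice_expansion f p"
    and \<omega>: "\<And>k. 1 \<le> k \<Longrightarrow> \<omega> k \<in> SBn k" and q: "norm q \<le> m / (2 + m)"
  shows "bohr_ineq m p \<omega> q"
proof -
  define r b where "r = norm q" and "b = 1 - norm (p 0) ^ 2"
  have r0: "0 \<le> r" by (simp add: r_def)
  have r2: "r * (2 + m) \<le> m"
    using q m by (simp add: r_def pos_le_divide_eq)
  have r1: "r < 1"
  proof (rule ccontr)
    assume "\<not> r < 1"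
    then have "1 * (2 + m) \<le> r * (2 + m)" using m by (intro mult_right_mono) auto
    with r2 show False by simp
  qed
  have p: "norm (p (Suc k)) \<le> b" for k
    unfolding b_def using f by (intro SB_coeff_bound) auto
  have b0: "0 \<le> b" using p [of 0] norm_ge_zero order_trans by blast
  have le: "norm (\<omega> (Suc k) q * p (Suc k)) \<le> (b * r) * r ^ k" for k
  proof -
    have "norm (\<omega> (Suc k) q) * norm (p (Suc k)) \<le> r ^ Suc k * b"
      using SBn_Schwarz [OF \<omega>, of "Suc k" q] p r0 r1
      by (intro mult_mono) (auto simp: r_def)
    then show ?thesis by (simp add: norm_mult mult_ac)
  qed
  have sums: "(\<lambda>k. (b * r) * r ^ k) sums ((b * r) * (1 / (1 - r)))"
    using r0 r1 by (intro sums_mult geometric_sums) simp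
  have summ: "summable (\<lambda>k. norm (\<omega> (Suc k) q * p (Suc k)))"
    by (rule summable_comparison_test' [OF sums_summable [OF sums], of 0]) (use le in simp)
  have "(\<Sum>k. norm (\<omega> (Suc k) q * p (Suc k))) \<le> (b * r) * (1 / (1 - r))"
    using suminf_le [OF le summ sums_summable [OF sums]] sums_unique [OF sums] by simp
  also have "\<dots> = b * (r / (1 - r))" by simp
  \<comment> \<open>For \<open>r < 1\<close> the condition \<open>r / (1 - r) \<le> m / 2\<close> is
    exactly \<open>r \<le> m / (2 + m)\<close>: this is where the radius comes from.\<close>
  also have "\<dots> \<le> b * (m / 2)"
    using r1 r2 b0 by (intro mult_left_mono) (simp_all add: field_simps)
  finally have "(\<Sum>k. norm (\<omega> (Suc k) q * p (Suc k))) \<le> m / 2 * b" by (simp add: mult.commute)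
  then show ?thesis
    using powr_Bernoulli [of "norm (p 0)" m] m summ by (simp add: bohr_ineq_def b_def)
qed

section \<open>Sharpness of the radius\<close>

text \<open>A function that acts on all slices through one and the same \<open>F\<close> has
  \<open>F\<close> times a constant as slice function, by left linearity of the projection. The
  extremal functions have this form.\<close>

lemma slice_regular_intrinsic:
  assumes F: "F holomorphic_on ball 0 1"
    and f: "\<And>I z. I \<in> imag_units \<Longrightarrow> z \<in> ball 0 1 \<Longrightarrow> f (slice_emb I z) = slice_emb I (F z)"
  shows "slice_regular f"
proof (rule slice_regularI)
  fix I c assume I: "I \<in> imag_units"
  have "(\<lambda>z. F z * slice_proj I c) holomorphic_on ball 0 1"
    by (intro holomorphic_intros F)
  then show "slice_fun I c f holomorphic_on ball 0 1"
    by (rule holomorphic_transform) (use f I in \<open>simp add: slice_fun_def slice_proj_emb_mult\<close>)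
qed

lemma monomial_in_SBn:
  assumes s: "0 < s" "s < 1"
  shows "(\<lambda>q. of_real s * q ^ k) \<in> SBn k"
proof -
  define \<omega> :: "quat \<Rightarrow> quat" where "\<omega> = (\<lambda>q. of_real s * q ^ k)"
  have emb: "\<omega> (slice_emb I z) = slice_emb I (of_real s * z ^ k)" if "I \<in> imag_units" for I z
    using that by (simp add: \<omega>_def slice_emb_mult slice_emb_power slice_emb_of_real)
  have reg: "slice_regular \<omega>"
    by (rule slice_regular_intrinsic [where F = "\<lambda>z. of_real s * z ^ k"])
      (auto intro!: holomorphic_intros emb)
  have "norm (\<omega> q) < 1" if "norm q \<le> 1" for q
  proof -
    have "norm (\<omega> q) = s * norm q ^ k"
      using s by (simp add: \<omega>_def norm_mult norm_power)
    also have "\<dots> \<le> s * 1"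
      using s that by (intro mult_left_mono power_le_one) auto
    finally show ?thesis using s by simp
  qed
  then have SB: "\<omega> \<in> SB"
    using reg by (auto simp: SB_def \<omega>_def intro!: continuous_intros)
  define I where "I = Quat 0 1 0 0"
  have I: "I \<in> imag_units" by (simp add: imag_units_iff I_def)
  \<comment> \<open>On one slice the slice function is a constant multiple of \<open>z ^ k\<close>.
    In its \<open>j\<close>-th derivative at \<open>0\<close> the factor \<open>0 ^ (k - j)\<close>
    vanishes for \<open>j < k\<close> and is \<open>1\<close> for \<open>j = k\<close>, where the
    Pochhammer symbol becomes \<open>fact k\<close>.\<close>
  have deriv: "slice_proj I ((slice_deriv ^^ j) \<omega> 0 * c) =
      of_real s * slice_proj I c * (pochhammer (of_nat (Suc k - j)) j * 0 ^ (k - j))" for j c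
  proof -
    have "slice_fun I c \<omega> = (\<lambda>z. (of_real s * slice_proj I c) * (z - 0) ^ k)"
      by (simp add: fun_eq_iff slice_fun_def emb [OF I] slice_proj_emb_mult [OF I] mult_ac)
    then have "(deriv ^^ j) (slice_fun I c \<omega>) 0 =
        (of_real s * slice_proj I c) * (deriv ^^ j) (\<lambda>z. (z - 0) ^ k) 0"
      by (simp only:) (rule higher_deriv_cmult [where A = UNIV]; auto intro!: holomorphic_intros)
    also have "(deriv ^^ j) (\<lambda>z::complex. (z - 0) ^ k) 0 = pochhammer (of_nat (Suc k - j)) j * (0 - 0) ^ (k - j)"
      by (rule higher_deriv_power)
    moreover have "slice_proj I ((slice_deriv ^^ j) \<omega> 0 * c) = (deriv ^^ j) (slice_fun I c \<omega>) 0"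
      using slice_fun_iterated_slice_deriv [OF reg I, of 0 c j]
      by (simp add: slice_fun_def slice_emb_0)
    ultimately show ?thesis by simp
  qed
  \<comment> \<open>Vanishing of the projections for every multiplier \<open>c\<close> forces the
    quaternion to vanish.\<close>
  have "(slice_deriv ^^ j) \<omega> 0 = 0" if "j < k" for j
    by (rule slice_proj_eqI [OF I]) (use that in \<open>simp add: deriv slice_proj_0\<close>)
  moreover have "(slice_deriv ^^ k) \<omega> 0 \<noteq> 0"
  proof
    assume "(slice_deriv ^^ k) \<omega> 0 = 0"
    with deriv [of k 1] s show False
      by (simp add: slice_proj_0 slice_proj_1 flip: pochhammer_fact)
  qed
  ultimately show ?thesis
    using SB unfolding \<omega>_def [symmetric] by (simp add: SBn_def)
qed

text \<open>Telescoping against \<open>1 - x\<close> exchanges only powers of the same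
  \<open>x\<close>, and the inverse is multiplied in on the right, so the argument survives
  noncommutativity.\<close>

lemma geometric_sums_div_algebra:
  fixes x :: "'a :: real_normed_div_algebra"
  assumes "norm x < 1"
  shows "(\<lambda>n. x ^ n) sums inverse (1 - x)"
proof -
  have "1 - x \<noteq> 0" using assms by auto
  then have inv: "(1 - x) * inverse (1 - x) = 1" by (rule right_inverse)
  have "(\<Sum>k<n. x ^ k) * (1 - x) = 1 - x ^ n" for n
  proof (induction n)
    case (Suc n)
    have "(\<Sum>k<Suc n. x ^ k) * (1 - x) = (\<Sum>k<n. x ^ k) * (1 - x) + x ^ n * (1 - x)"
      by (simp add: distrib_right)
    also have "\<dots> = 1 - x ^ Suc n"
      unfolding Suc.IH by (simp add: right_diff_distrib power_commutes)
    finally show ?case .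
  qed simp
  then have "(\<Sum>k<n. x ^ k) * ((1 - x) * inverse (1 - x)) = (1 - x ^ n) * inverse (1 - x)" for n
    by (simp only: flip: mult.assoc)
  then have "(\<Sum>k<n. x ^ k) = (1 - x ^ n) * inverse (1 - x)" for n
    by (simp add: inv)
  moreover have "(\<lambda>n. (1 - x ^ n) * inverse (1 - x)) \<longlonglongrightarrow> (1 - 0) * inverse (1 - x)"
    by (intro tendsto_intros LIMSEQ_power_zero assms)
  ultimately show ?thesis by (simp add: sums_def)
qed

text \<open>Since \<open>a\<close> is real, numerator and denominator commute and every slice is
  mapped to itself, so the pointwise quotient is slice regular where the denominator has no
  zero.\<close>

definition quat_moebius :: "real \<Rightarrow> real \<Rightarrow> quat \<Rightarrow> quat" where
  "quat_moebius s a q = of_real s * ((of_real a - q) * inverse (1 - of_real a * q))"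

text \<open>From \<open>(a - q) / (1 - a q) = a - (1 - a^2) (q + a q^2 + ...)\<close>, scaled by
  \<open>s\<close>.\<close>

definition moebius_coeff :: "real \<Rightarrow> real \<Rightarrow> nat \<Rightarrow> real" where
  "moebius_coeff s a k = (if k = 0 then s * a else - (s * (1 - a\<^sup>2) * a ^ (k - 1)))"

lemma quat_moebius_denominator:
  assumes "0 < a" "a < 1" "norm (q :: quat) \<le> 1"
  shows "norm (of_real a * q) < 1" and "1 - of_real a * q \<noteq> 0"
proof -
  have "a * norm q \<le> a * 1" using assms by (intro mult_left_mono) auto
  then have "a * norm q < 1" using assms(2) by linarith
  then show *: "norm (of_real a * q) < 1" using assms by (simp add: norm_mult)
  show "1 - of_real a * q \<noteq> 0"
  proof
    assume "1 - of_real a * q = 0"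
    then have "of_real a * q = 1" by simp
    with * show False by simp
  qed
qed

text \<open>The identity \<open>(1 - a^2) (1 - |q|^2) = |1 - a q|^2 - |a - q|^2\<close> bounds the
  unscaled map by \<open>1\<close> on the closed ball, and \<open>s < 1\<close> makes the bound
  strict. Regularity is inherited from the complex Moebius map.\<close>

lemma quat_moebius_in_SB:
  assumes s: "0 < s" "s < 1" and a: "0 < a" "a < 1"
  shows "quat_moebius s a \<in> SB"
proof -
  have den: "1 - of_real a * z \<noteq> 0" if "norm z < 1" for z :: complex
  proof
    assume "1 - of_real a * z = 0"
    then have "norm (of_real a * z) = 1" by (metis eq_iff_diff_eq_0 norm_one)
    moreover have "a * norm z < 1 * 1" using a that by (intro mult_strict_mono) auto
    ultimately show False using a by (simp add: norm_mult)
  qed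
  have "slice_regular (quat_moebius s a)"
  proof (rule slice_regular_intrinsic)
    show "(\<lambda>z. of_real s * ((of_real a - z) * inverse (1 - of_real a * z))) holomorphic_on ball 0 1"
      using den by (auto intro!: holomorphic_intros)
    fix I and z :: complex assume I: "I \<in> imag_units" and z: "z \<in> ball 0 1"
    have sub: "slice_emb I (u - v) = slice_emb I u - slice_emb I v" for u v
      by (rule linear_diff [OF bounded_linear.linear [OF bounded_linear_slice_emb]])
    have "slice_emb I (1 - of_real a * z) * slice_emb I (inverse (1 - of_real a * z)) = 1"
      using den [of z] z by (simp add: slice_emb_1 flip: slice_emb_mult [OF I])
    then have "slice_emb I (inverse (1 - of_real a * z)) = inverse (slice_emb I (1 - of_real a * z))"
      by (metis inverse_unique)
    then show "quat_moebius s a (slice_emb I z) =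
        slice_emb I (of_real s * ((of_real a - z) * inverse (1 - of_real a * z)))"
      by (simp add: quat_moebius_def slice_emb_mult [OF I] sub slice_emb_of_real slice_emb_1)
  qed
  moreover have "continuous_on (cball 0 1) (quat_moebius s a)"
    unfolding quat_moebius_def using quat_moebius_denominator(2) [OF a]
    by (intro continuous_intros) auto
  moreover have "norm (quat_moebius s a q) < 1" if q: "norm q \<le> 1" for q
  proof -
    have norm_sq: "(norm v)\<^sup>2 = (qRe v)\<^sup>2 + (qI v)\<^sup>2 + (qJ v)\<^sup>2 + (qK v)\<^sup>2" for v :: quat
      by (simp add: norm_quat_def)
    define N where "N = (qRe q)\<^sup>2 + (qI q)\<^sup>2 + (qJ q)\<^sup>2 + (qK q)\<^sup>2"
    have "N \<le> 1" using q by (simp add: norm_quat_def N_def)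
    then have "0 \<le> (1 - a\<^sup>2) * (1 - N)"
      using a by (intro mult_nonneg_nonneg) (auto simp: power_le_one)
    also have "\<dots> = (norm (1 - of_real a * q))\<^sup>2 - (norm (of_real a - q))\<^sup>2"
      unfolding norm_sq N_def by (simp add: power2_eq_square algebra_simps)
    finally have "(norm (of_real a - q))\<^sup>2 \<le> (norm (1 - of_real a * q))\<^sup>2"
      by (simp only: diff_ge_0_iff_ge)
    then have le: "norm (of_real a - q) \<le> norm (1 - of_real a * q)"
      by (rule power2_le_imp_le) simp
    have pos: "0 < norm (1 - of_real a * q)"
      using quat_moebius_denominator(2) [OF a q] by simp
    have "norm (quat_moebius s a q) = s * (norm (of_real a - q) / norm (1 - of_real a * q))"
      using s by (simp add: quat_moebius_def norm_mult norm_inverse divide_inverse)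
    also have "\<dots> \<le> s * 1"
      using le pos s by (intro mult_left_mono) auto
    finally show ?thesis using s by simp
  qed
  ultimately show ?thesis by (simp add: SB_def)
qed

text \<open>With \<open>y\<close> the inverse of \<open>1 - a q\<close>, the relation
  \<open>y = 1 + a q y\<close> gives \<open>(a - q) y = a - (1 - a^2) q y\<close>, and
  \<open>y\<close> is a geometric series.\<close>

lemma quat_moebius_expansion:
  assumes a: "0 < a" "a < 1"
  shows "has_slice_expansion (quat_moebius s a) (\<lambda>k. of_real (moebius_coeff s a k))"
  unfolding has_slice_expansion_def
proof
  fix q :: quat assume "q \<in> ball 0 1"
  then have q: "norm q \<le> 1" by simp
  define y where "y = inverse (1 - of_real a * q)"
  define b where "b = - (s * (1 - a\<^sup>2))"
  have "(\<lambda>k. (of_real a * q) ^ k) sums y"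
    unfolding y_def using quat_moebius_denominator(1) [OF a q] by (rule geometric_sums_div_algebra)
  then have "(\<lambda>k. b *\<^sub>R (q * (of_real a * q) ^ k)) sums (b *\<^sub>R (q * y))"
    by (intro sums_scaleR_right sums_mult)
  moreover have "b *\<^sub>R (q * (of_real a * q) ^ k) = q ^ Suc k * of_real (moebius_coeff s a (Suc k))" for k
  proof -
    have "(of_real a * q) ^ k = a ^ k *\<^sub>R q ^ k"
      by (metis scaleR_conv_of_real scaleR_power)
    moreover have "q ^ Suc k * of_real t = t *\<^sub>R (q * q ^ k)" for t
      by (simp add: of_real_def)
    moreover have "moebius_coeff s a (Suc k) = b * a ^ k"
      by (simp add: moebius_coeff_def b_def)
    ultimately show ?thesis
      by (simp del: power_Suc of_real_mult)
  qed
  ultimately have "(\<lambda>k. q ^ Suc k * of_real (moebius_coeff s a (Suc k))) sums (b *\<^sub>R (q * y))"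
    by simp
  then have "(\<lambda>k. q ^ k * of_real (moebius_coeff s a k)) sums
      (b *\<^sub>R (q * y) + q ^ 0 * of_real (moebius_coeff s a 0))"
    by (rule sums_Suc)
  moreover have "quat_moebius s a q = b *\<^sub>R (q * y) + q ^ 0 * of_real (moebius_coeff s a 0)"
  proof -
    have "(1 - of_real a * q) * y = 1"
      unfolding y_def using quat_moebius_denominator(2) [OF a q] by (rule right_inverse)
    then have "y - a *\<^sub>R (q * y) = 1"
      by (simp add: left_diff_distrib mult.assoc scaleR_conv_of_real)
    then have "y = 1 + a *\<^sub>R (q * y)"
      by (simp only: diff_eq_eq)
    then have "a *\<^sub>R y = a *\<^sub>R (1 + a *\<^sub>R (q * y))"
      by (rule arg_cong)
    then have "a *\<^sub>R y - q * y = a *\<^sub>R 1 - (1 - a\<^sup>2) *\<^sub>R (q * y)"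
      by (simp only:) (simp add: algebra_simps power2_eq_square)
    moreover have "quat_moebius s a q = s *\<^sub>R (a *\<^sub>R y - q * y)"
      by (simp add: quat_moebius_def y_def left_diff_distrib scaleR_conv_of_real)
    ultimately have "quat_moebius s a q = s *\<^sub>R (a *\<^sub>R 1 - (1 - a\<^sup>2) *\<^sub>R (q * y))"
      by (simp only:)
    also have "\<dots> = b *\<^sub>R (q * y) + (s * a) *\<^sub>R 1"
      by (simp add: b_def scaleR_diff_right)
    finally show ?thesis
      by (simp add: moebius_coeff_def of_real_def)
  qed
  ultimately show "(\<lambda>k. q ^ k * of_real (moebius_coeff s a k)) sums quat_moebius s a q"
    by simp
qed

text \<open>
  At \<open>a = 1\<close> the left-hand side equals \<open>1\<close> and has derivative \<open>m - 2 r / (1 - r)\<close>,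
  which is negative exactly when \<open>r\<close> exceeds the Bohr radius.
\<close>

lemma moebius_parameters_exist:
  fixes m r :: real
  assumes m: "0 < m" and r: "m / (2 + m) < r" "r < 1"
  obtains s a where "0 < s" "s < 1" "0 < a" "a < 1"
    "1 < (s * a) powr m + s\<^sup>2 * ((1 - a\<^sup>2) * r / (1 - a * r))"
proof -
  have r0: "0 < r" using m r by (meson add_pos_pos divide_pos_pos less_trans zero_less_numeral)
  have "m < r * (2 + m)" using r m by (simp add: pos_divide_less_eq)
  then have neg: "m - 2 * r / (1 - r) < 0" using r by (simp add: field_simps)
  define \<phi> where "\<phi> a = a powr m + (1 - a\<^sup>2) * r / (1 - a * r)" for a
  have "(\<phi> has_real_derivative m - 2 * r / (1 - r)) (at 1)"
    unfolding \<phi>_def using r by (auto intro!: derivative_eq_intros)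
  \<comment> \<open>Here \<open>\<phi> 1 = 1\<close>, since \<open>1 - a^2\<close> vanishes at
    \<open>a = 1\<close>; a negative derivative puts values above \<open>1\<close> just to the
    left.\<close>
  then obtain d where d: "0 < d" "\<And>h. 0 < h \<Longrightarrow> h < d \<Longrightarrow> \<phi> 1 < \<phi> (1 - h)"
    using DERIV_neg_dec_left [OF _ neg] by blast
  define a where "a = 1 - min (d / 2) (1 / 2)"
  have a: "0 < a" "a < 1" using d(1) by (auto simp: a_def)
  have "\<phi> 1 < \<phi> a" unfolding a_def using d(1) by (intro d(2)) auto
  then have gt: "1 < (1 * a) powr m + 1\<^sup>2 * ((1 - a\<^sup>2) * r / (1 - a * r))"
    by (simp add: \<phi>_def)
  \<comment> \<open>By continuity the strict inequality at \<open>s = 1\<close> persists for some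
    \<open>s < 1\<close>. The square collects one \<open>s\<close> from the coefficients and one
    from the monomials.\<close>
  have "((\<lambda>s. (s * a) powr m + s\<^sup>2 * ((1 - a\<^sup>2) * r / (1 - a * r))) \<longlongrightarrow>
      (1 * a) powr m + 1\<^sup>2 * ((1 - a\<^sup>2) * r / (1 - a * r))) (at_left 1)"
    using a by (intro tendsto_add tendsto_powr tendsto_mult tendsto_power tendsto_const tendsto_ident_at) auto
  then have "eventually (\<lambda>s. 1 < (s * a) powr m + s\<^sup>2 * ((1 - a\<^sup>2) * r / (1 - a * r))) (at_left 1)"
    using gt by (rule order_tendstoD)
  moreover have "eventually (\<lambda>s::real. s \<in> {0<..<1}) (at_left 1)"
    by (rule eventually_at_left_real) simp
  ultimately have "eventually (\<lambda>s. s \<in> {0<..<1} \<and>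
      1 < (s * a) powr m + s\<^sup>2 * ((1 - a\<^sup>2) * r / (1 - a * r))) (at_left 1)"
    by eventually_elim simp
  then obtain s where "s \<in> {0<..<1}" "1 < (s * a) powr m + s\<^sup>2 * ((1 - a\<^sup>2) * r / (1 - a * r))"
    using eventually_happens' [OF trivial_limit_at_left_real] by blast
  with a show thesis by (intro that [of s a]) auto
qed

lemma bohr_radius_sharp:
  assumes m: "0 < m" "m \<le> 2" and R: "m / (2 + m) < R"
  shows "\<exists>f p \<omega>. f \<in> SB \<and> has_slice_expansion f p \<and> (\<forall>k\<ge>1. \<omega> k \<in> SBn k) \<and>
    (\<exists>q \<in> cball 0 1. norm q \<le> R \<and> \<not> bohr_ineq m p \<omega> q)"
proof -
  \<comment> \<open>\<open>R\<close> may be \<open>1\<close> or more, so it is capped;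
    \<open>3 / 4\<close> is admissible because \<open>m / (2 + m) \<le> 1 / 2\<close>.\<close>
  define r where "r = min R (3 / 4)"
  have "m / (2 + m) < 3 / 4" using m by (simp add: field_simps)
  then have r: "m / (2 + m) < r" "r < 1" "r \<le> R"
    using R by (auto simp: r_def)
  have r0: "0 < r" using m r(1) by (meson add_pos_pos divide_pos_pos less_trans zero_less_numeral)
  obtain s a where s: "0 < s" "s < 1" and a: "0 < a" "a < 1"
    and gt: "1 < (s * a) powr m + s\<^sup>2 * ((1 - a\<^sup>2) * r / (1 - a * r))"
    using moebius_parameters_exist [OF m(1) r(1,2)] .
  define p :: "nat \<Rightarrow> quat" where "p = (\<lambda>k. of_real (moebius_coeff s a k))"
  define \<omega> :: "nat \<Rightarrow> quat \<Rightarrow> quat" where "\<omega> = (\<lambda>k q. of_real s * q ^ k)"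
  have a2: "a\<^sup>2 < 1" using a by (simp add: power_less_one_iff)
  have ar: "0 < a * r" "a * r < 1"
    using a r r0 mult_strict_mono [of a 1 r 1] by auto
  have "(\<lambda>k. (s\<^sup>2 * (1 - a\<^sup>2) * r) * (a * r) ^ k) sums ((s\<^sup>2 * (1 - a\<^sup>2) * r) * (1 / (1 - a * r)))"
    using ar by (intro sums_mult geometric_sums) simp
  moreover have "norm (\<omega> (Suc k) (of_real r) * p (Suc k)) = (s\<^sup>2 * (1 - a\<^sup>2) * r) * (a * r) ^ k" for k
  proof -
    have "norm (p (Suc k)) = s * (1 - a\<^sup>2) * a ^ k"
      unfolding p_def norm_of_real using s a a2 by (simp add: moebius_coeff_def abs_mult)
    moreover have "norm (\<omega> (Suc k) (of_real r)) = s * r ^ Suc k"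
      using s r0 by (simp add: \<omega>_def norm_mult norm_power)
    ultimately show ?thesis
      by (simp add: norm_mult power2_eq_square power_mult_distrib mult_ac)
  qed
  ultimately have "(\<lambda>k. norm (\<omega> (Suc k) (of_real r) * p (Suc k))) sums
      ((s\<^sup>2 * (1 - a\<^sup>2) * r) * (1 / (1 - a * r)))"
    by simp
  then have "(\<Sum>k. norm (\<omega> (Suc k) (of_real r) * p (Suc k))) = s\<^sup>2 * ((1 - a\<^sup>2) * r / (1 - a * r))"
    by (simp add: sums_iff)
  moreover have "norm (p 0) = s * a"
    unfolding p_def norm_of_real using s a by (simp add: moebius_coeff_def abs_mult)
  \<comment> \<open>The series converges at the real point \<open>r\<close>; what fails is the bound
    on its sum.\<close>
  ultimately have "\<not> bohr_ineq m p \<omega> (of_real r)"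
    using gt by (simp add: bohr_ineq_def)
  moreover have "quat_moebius s a \<in> SB" "has_slice_expansion (quat_moebius s a) p" "\<forall>k\<ge>1. \<omega> k \<in> SBn k"
    using quat_moebius_in_SB [OF s a] quat_moebius_expansion [OF a] monomial_in_SBn [OF s]
    by (simp_all add: p_def \<omega>_def)
  moreover have "of_real r \<in> cball (0::quat) 1" "norm (of_real r :: quat) \<le> R"
    using r r0 by simp_all
  ultimately show ?thesis by blast
qed

theorem theorem1p4:
  fixes m :: real
  assumes "0 < m" and "m \<le> 2"
  shows "(\<forall>f p \<omega>. f \<in> SB \<and> has_slice_expansion f p \<and> (\<forall>k\<ge>1. \<omega> k \<in> SBn k) \<longrightarrow>
            (\<forall>q. norm q \<le> m / (2 + m) \<longrightarrow> bohr_ineq m p \<omega> q)) \<and>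
         (\<forall>R > m / (2 + m). \<exists>f p \<omega>. f \<in> SB \<and> has_slice_expansion f p \<and> (\<forall>k\<ge>1. \<omega> k \<in> SBn k) \<and>
            (\<exists>q \<in> cball 0 1. norm q \<le> R \<and> \<not> bohr_ineq m p \<omega> q))"
  using SB_bohr_ineq [OF assms] bohr_radius_sharp [OF assms] by blast

end
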